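(* Let $E$ be a locally finite graph without sinks and $(X,\sigma)$ the associated Deaconu-Renault system. Then $h_d(\sigma)=h_G(E)$, where $h_d(\sigma)$ is the metric entropy of $(X,\sigma)$ with respect to the metric $d_X$, and $h_G(E)$ is the Gurevich entropy of $E$.
   Context: $\mathbb N=\{1,2,\dots\}$. A graph is a quadruple $E=(E^0,E^1,r,s)$ with countable sets $E^0$ of vertices and $E^1$ of edges and maps $r,s:E^1\to E^0$ (range and source). It has no sinks if $s^{-1}(v)\neq\emptyset$ for all $v$; it is row-finite if $|s^{-1}(v)|<\infty$ for all $v\in E^0$, and locally finite if it is row-finite and $|r^{-1}(v)|<\infty$ for all $v\in E^0$. A path of length $n$ is a sequence $e_1\dots e_n$ of edges with $s(e_{i+1})=r(e_i)$; infinite paths are defined similarly. The associated Deaconu-Renault system is $(X,\sigma)$ where $X$ is the set of infinite paths in $E$ with the topology generated by cylinder sets (sets of infinite paths with a given finite initial segment), and $\sigma:X\to X$ is the shift $\sigma(x_1x_2\dots)=x_2x_3\dots$, $Dom(\sigma)=X$. Metric $d_X$. Let $\mathfrak p$ be the countable set consisting of all finite paths of length $\geq1$ together with all nonempty finite subsets of $E^0$ (regarded as paths of length $0$). A finite path $\beta$ of length $\ge 1$ is an initial segment of $x\in X$ if $x=\beta\gamma$ for some infinite path $\gamma$; a finite set $A\subseteq E^0$ is an initial segment of $x$ if $s(x):=s(x_1)\in A$. Fix an enumeration $\mathfrak p=\{p_1,p_2,\dots\}$ and set $d_X(x,x)=0$ and, for $x\ne y$, $d_X(x,y)=2^{-i}$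 where $i$ is the smallest index such that $p_i$ is an initial segment of exactly one of $x,y$. This metric induces the topology of $X$, and the metric entropy does not depend on the enumeration. Metric entropy (here $Dom(\sigma^n)=X$ for all $n$, and $d=d_X$). $d_n(x,y)=\max_{0\le i\le n-1}d(\sigma^i(x),\sigma^i(y))$; for $K\subseteq X$ compact, $sep(n,\varepsilon,\sigma,K)$ is the largest cardinality of a set $A\subseteq K$ with $d_n(x,y)>\varepsilon$ for all distinct $x,y\in A$; $h_d(\sigma,K)=\lim_{\varepsilon\to0}\limsup_{n\to\infty}\frac1n\log sep(n,\varepsilon,\sigma,K)$ (with $\log 0:=0$); $h_d(\sigma)=\sup_Kh_d(\sigma,K)$ over compact $K\subseteq X$. Gurevich entropy. $h_G(E)=\sup_H h(X_H,\sigma)$, the supremum over all finite connected subgraphs $H$ of $E$, where $h(X_H,\sigma)$ is the usual topological entropy of the shift map on the compact space $X_H$ of infinite paths in $H$. *)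

theory Defs
  imports
    "HOL-Analysis.Analysis"
    "HOL-Library.Stream"
    "Graph_Theory.Digraph_Component"
begin

text \<open>
  A graph \<open>(E\<^sup>0, E\<^sup>1, r, s)\<close> is a well-formed \<open>pre_digraph\<close> \<open>E\<close> with countable \<open>verts E\<close> and
  \<open>arcs E\<close>; the source map is \<open>tail E\<close> and the range map is \<open>head E\<close>.
  Parallel edges and loops are allowed, and so is the empty graph.
\<close>

definition countable_graph :: "('v, 'e) pre_digraph \<Rightarrow> bool" where
  "countable_graph E \<longleftrightarrow> wf_digraph E \<and> countable (verts E) \<and> countable (arcs E)"

definition no_sinks :: "('v, 'e) pre_digraph \<Rightarrow> bool" where
  "no_sinks E \<longleftrightarrow> (\<forall>v\<in>verts E. out_arcs E v \<noteq> {})"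

definition row_finite :: "('v, 'e) pre_digraph \<Rightarrow> bool" where
  "row_finite E \<longleftrightarrow> (\<forall>v\<in>verts E. finite (out_arcs E v))"

definition locally_finite :: "('v, 'e) pre_digraph \<Rightarrow> bool" where
  "locally_finite E \<longleftrightarrow> row_finite E \<and> (\<forall>v\<in>verts E. finite (in_arcs E v))"


section \<open>Path spaces\<close>

definition finite_paths :: "('v, 'e) pre_digraph \<Rightarrow> 'e list set" where
  "finite_paths E = {b. b \<noteq> [] \<and> set b \<subseteq> arcs E \<and>
     (\<forall>i. Suc i < length b \<longrightarrow> tail E (b ! Suc i) = head E (b ! i))}"

definition infinite_paths :: "('v, 'e) pre_digraph \<Rightarrow> 'e stream set" where
  "infinite_paths E = {x. sset x \<subseteq> arcs E \<and> (\<forall>i. tail E (x !! Suc i) = head E (x !! i))}"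

definition cylinder :: "('v, 'e) pre_digraph \<Rightarrow> 'e list \<Rightarrow> 'e stream set" where
  "cylinder E b = {b @- y | y. y \<in> infinite_paths E} \<inter> infinite_paths E"

text \<open>
  Cylinders of paths of length at least \<open>1\<close> suffice: they cover the path space, and the cylinder
  of a vertex \<open>v\<close> is the union of the cylinders of the edges with source \<open>v\<close>.
\<close>

definition path_topology :: "('v, 'e) pre_digraph \<Rightarrow> 'e stream topology" where
  "path_topology E = topology_generated_by (cylinder E ` finite_paths E)"


section \<open>The metric on the path space\<close>

text \<open>\<open>Inl b\<close> is a path of length at least \<open>1\<close>, \<open>Inr A\<close> a nonempty finite set of vertices.\<close>

definition segments :: "('v, 'e) pre_digraph \<Rightarrow> ('e list + 'v set) set" where
  "segments E = finite_paths E <+> {A. A \<subseteq> verts E \<and> finite A \<and> A \<noteq> {}}"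

fun initial_segment :: "('v, 'e) pre_digraph \<Rightarrow> 'e list + 'v set \<Rightarrow> 'e stream \<Rightarrow> bool" where
  "initial_segment E (Inl b) x \<longleftrightarrow> (\<exists>y\<in>infinite_paths E. x = b @- y)"
| "initial_segment E (Inr A) x \<longleftrightarrow> tail E (shd x) \<in> A"

text \<open>
  Indices start at \<open>1\<close>. The set \<open>segments E\<close> is infinite for every nonempty graph without sinks,
  and then the index set is \<open>{1..}\<close>; the general form also covers the empty graph.
\<close>

definition index_set :: "'a set \<Rightarrow> nat set" where
  "index_set P = {i. 1 \<le> i \<and> (finite P \<longrightarrow> i \<le> card P)}"

definition enumerates :: "(nat \<Rightarrow> 'a) \<Rightarrow> 'a set \<Rightarrow> bool" where
  "enumerates p P \<longleftrightarrow> bij_betw p (index_set P) P"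

definition path_dist ::
  "('v, 'e) pre_digraph \<Rightarrow> (nat \<Rightarrow> 'e list + 'v set) \<Rightarrow> 'e stream \<Rightarrow> 'e stream \<Rightarrow> real" where
  "path_dist E p x y =
     (if x = y then 0
      else (1/2) ^ (LEAST i. i \<in> index_set (segments E) \<and>
                       initial_segment E (p i) x \<noteq> initial_segment E (p i) y))"


section \<open>Metric entropy\<close>

text \<open>
  All entropies take values in \<open>[0, \<infinity>]\<close>; the convention \<open>log 0 = 0\<close> is built into \<open>ln\<close>.
  The values of the sequences below at \<open>n = 0\<close> are irrelevant for the upper limits.
\<close>

definition bowen_dist :: "('a \<Rightarrow> 'a \<Rightarrow> real) \<Rightarrow> ('a \<Rightarrow> 'a) \<Rightarrow> nat \<Rightarrow> 'a \<Rightarrow> 'a \<Rightarrow> real" where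
  "bowen_dist d f n x y = Max ((\<lambda>i. d ((f ^^ i) x) ((f ^^ i) y)) ` {..<n})"

text \<open>The maximum exists whenever \<open>K\<close> is compact in a topology induced by \<open>d\<close> with \<open>f\<close> continuous.\<close>

definition sep :: "('a \<Rightarrow> 'a \<Rightarrow> real) \<Rightarrow> nat \<Rightarrow> real \<Rightarrow> ('a \<Rightarrow> 'a) \<Rightarrow> 'a set \<Rightarrow> nat" where
  "sep d n \<epsilon> f K = Max {card A | A. A \<subseteq> K \<and> finite A \<and>
     (\<forall>x\<in>A. \<forall>y\<in>A. x \<noteq> y \<longrightarrow> bowen_dist d f n x y > \<epsilon>)}"

definition metric_entropy_on ::
  "('a \<Rightarrow> 'a \<Rightarrow> real) \<Rightarrow> ('a \<Rightarrow> 'a) \<Rightarrow> 'a set \<Rightarrow> ennreal" where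
  "metric_entropy_on d f K =
     Lim (at_right 0) (\<lambda>\<epsilon>. limsup (\<lambda>n. ennreal (ln (real (sep d n \<epsilon> f K)) / real n)))"

definition metric_entropy ::
  "'a topology \<Rightarrow> ('a \<Rightarrow> 'a \<Rightarrow> real) \<Rightarrow> ('a \<Rightarrow> 'a) \<Rightarrow> ennreal" where
  "metric_entropy T d f = (SUP K\<in>{K. compactin T K}. metric_entropy_on d f K)"


section \<open>Topological and Gurevich entropy\<close>

text \<open>
  Topological entropy of a continuous self-map of a compact space, by open covers
  (Adler, Konheim, McAndrew). The upper limit is a limit, by subadditivity.
\<close>

definition open_cover :: "'a topology \<Rightarrow> 'a set set \<Rightarrow> bool" where
  "open_cover T \<U> \<longleftrightarrow> (\<forall>U\<in>\<U>. openin T U) \<and> \<Union>\<U> = topspace T"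

definition min_subcover_card :: "'a topology \<Rightarrow> 'a set set \<Rightarrow> nat" where
  "min_subcover_card T \<U> = (LEAST k. \<exists>\<V>\<subseteq>\<U>. finite \<V> \<and> card \<V> = k \<and> \<Union>\<V> = topspace T)"

text \<open>The join of the covers \<open>f\<^sup>-\<^sup>i \<U>\<close> for \<open>i < n\<close>.\<close>

definition iterated_join ::
  "'a topology \<Rightarrow> ('a \<Rightarrow> 'a) \<Rightarrow> nat \<Rightarrow> 'a set set \<Rightarrow> 'a set set" where
  "iterated_join T f n \<U> =
     {{x \<in> topspace T. \<forall>i<n. (f ^^ i) x \<in> u i} | u. \<forall>i<n. u i \<in> \<U>}"

definition topological_entropy :: "'a topology \<Rightarrow> ('a \<Rightarrow> 'a) \<Rightarrow> ennreal" where
  "topological_entropy T f =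
     (SUP \<U>\<in>{\<U>. open_cover T \<U>}.
        limsup (\<lambda>n. ennreal (ln (real (min_subcover_card T (iterated_join T f n \<U>))) / real n)))"

text \<open>
  \<open>Digraph_Component.connected\<close> means connectedness of the underlying undirected graph; requiring
  strong connectedness would give the same supremum, as the entropy of a finite graph is attained
  on a strongly connected component (unless it has no infinite paths, and then its entropy is \<open>0\<close>).
\<close>

definition gurevich_entropy :: "('v, 'e) pre_digraph \<Rightarrow> ennreal" where
  "gurevich_entropy E =
     (SUP H\<in>{H. subgraph H E \<and> fin_digraph H \<and> Digraph_Component.connected H}.
        topological_entropy (path_topology H) stl)"

end

theory Submission
  imports Defs "HOL-Real_Asymp.Real_Asymp"
begin

text \<open>
  For a finite subgraph \<open>H\<close>, the space of infinite paths of \<open>H\<close> is compact and invariant, and points with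
  distinct initial words are uniformly separated in the metric of the ambient graph; this gives
  \<open>h\<^sub>G \<le> h\<^sub>d\<close>. For the converse, fix a scale \<open>\<epsilon>\<close>: only finitely many segments matter, so a point is
  seen only through its itinerary, which records an edge when its source lies in a suitable finite set
  \<open>S\<close> of vertices and is blank otherwise. Closed paths of length \<open>l\<close> at a vertex can be concatenated
  freely inside a finite connected subgraph, hence there are at most \<open>exp (l h\<^sub>G)\<close> of them, without any
  multiplicative constant. Cutting an itinerary at the first and the last visit to a vertex \<open>v\<close> leaves
  a closed path at \<open>v\<close> between two itineraries that ignore \<open>v\<close>, so that by induction on \<open>S\<close> there are
  at most polynomially many times \<open>exp (n h\<^sub>G)\<close> itineraries of length \<open>n\<close>. The blanks are what
  keeps the long excursions from \<open>S\<close> through infinite parts of the graph from being counted.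
\<close>

section \<open>Infinite paths\<close>

lemma funpow_stl: "(stl ^^ n) x = sdrop n x"
  by (induction n arbitrary: x) (auto simp: funpow_Suc_right simp del: funpow.simps)

lemma infinite_paths_iff:
  "x \<in> infinite_paths E \<longleftrightarrow> (\<forall>i. x !! i \<in> arcs E \<and> tail E (x !! Suc i) = head E (x !! i))"
  unfolding infinite_paths_def by (auto simp: sset_range)

lemma sdrop_infinite_paths: "x \<in> infinite_paths E \<Longrightarrow> sdrop n x \<in> infinite_paths E"
  by (simp add: infinite_paths_iff sdrop_snth)

lemma stl_infinite_paths: "x \<in> infinite_paths E \<Longrightarrow> stl x \<in> infinite_paths E"
  using sdrop_infinite_paths[of x E 1] by simp

lemma infinite_paths_subgraph:
  assumes "subgraph H E"
  shows "infinite_paths H \<subseteq> infinite_paths E"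
  using assms unfolding infinite_paths_def subgraph_def compatible_def by auto

lemma stake_finite_paths:
  assumes "x \<in> infinite_paths E" "n > 0"
  shows "stake n x \<in> finite_paths E"
  using assms unfolding finite_paths_def
  by (auto simp: infinite_paths_iff in_set_conv_nth)

lemma initial_segment_Inl_iff:
  assumes "x \<in> infinite_paths E"
  shows "initial_segment E (Inl b) x \<longleftrightarrow> stake (length b) x = b"
proof
  assume "stake (length b) x = b"
  then have "x = b @- sdrop (length b) x"
    by (metis stake_sdrop)
  then show "initial_segment E (Inl b) x"
    using sdrop_infinite_paths[OF assms] by auto
qed (auto simp: stake_shift)

lemma cylinder_eq: "cylinder E b = {x \<in> infinite_paths E. stake (length b) x = b}"
  using initial_segment_Inl_iff[of _ E b] unfolding cylinder_def by auto

lemma topspace_path_topology [simp]: "topspace (path_topology E) = infinite_paths E"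
proof
  show "infinite_paths E \<subseteq> topspace (path_topology E)"
  proof
    fix x assume "x \<in> infinite_paths E"
    then have "x \<in> cylinder E (stake 1 x)" "stake 1 x \<in> finite_paths E"
      using stake_finite_paths[of x E 1] by (auto simp: cylinder_eq)
    then show "x \<in> topspace (path_topology E)"
      unfolding path_topology_def by auto
  qed
qed (auto simp: path_topology_def cylinder_eq)

section \<open>Topology and compactness in terms of prefixes\<close>

lemma openin_prefix:
  assumes "x \<in> infinite_paths E" "n > 0"
  shows "openin (path_topology E) {y \<in> infinite_paths E. stake n y = stake n x}"
proof -
  have "{y \<in> infinite_paths E. stake n y = stake n x} = cylinder E (stake n x)"
    by (auto simp: cylinder_eq)
  then show ?thesis
    unfolding path_topology_def
    using stake_finite_paths[OF assms] by (auto intro: topology_generated_by_Basis)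
qed

lemma stake_eq_mono: "stake n x = stake n y \<Longrightarrow> m \<le> n \<Longrightarrow> stake m x = stake m y"
  by (metis min.absorb1 take_stake)

lemma stake_eq_iff: "stake n x = stake n y \<longleftrightarrow> (\<forall>i<n. x !! i = y !! i)"
  by (auto simp: list_eq_iff_nth_eq)

text \<open>Prefix sets form a neighbourhood base. The property survives the generation of the
  topology: take the larger of two lengths at an intersection, and the length for a member
  containing \<open>x\<close> at a union.\<close>

lemma openin_path_topology_prefix:
  assumes "openin (path_topology E) U" "x \<in> U"
  shows "\<exists>n>0. {y \<in> infinite_paths E. stake n y = stake n x} \<subseteq> U"
proof -
  have "generate_topology_on (cylinder E ` finite_paths E) U"
    using assms(1) unfolding path_topology_def by (rule openin_topology_generated_by)
  then show ?thesis using assms(2)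
  proof (induction arbitrary: x)
    case (Int U V)
    then obtain m n where "m > 0" "{y \<in> infinite_paths E. stake m y = stake m x} \<subseteq> U"
      "n > 0" "{y \<in> infinite_paths E. stake n y = stake n x} \<subseteq> V"
      by blast
    then show ?case
      by (intro exI[of _ "max m n"])
         (auto intro: stake_eq_mono[OF _ max.cobounded1] stake_eq_mono[OF _ max.cobounded2])
  next
    case (UN K)
    then obtain k where k: "k \<in> K" "x \<in> k" by blast
    from UN.IH[OF this] k show ?case by blast
  next
    case (Basis U)
    then obtain b where b: "b \<in> finite_paths E" "U = cylinder E b" by blast
    then have "length b > 0" by (auto simp: finite_paths_def)
    with b Basis show ?case by (intro exI[of _ "length b"]) (auto simp: cylinder_eq)
  qed auto
qed

text \<open>By Tychonoff the edge sequences over the finite set \<open>arcs H\<close> form a compact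
  product, and the path condition cuts out a closed set \<open>C\<close>, whose continuous image
  under \<open>smap f nats\<close> is the path space of \<open>H\<close>. With the topology of
  \<open>E\<close> as target, this serves for \<open>H\<close> inside \<open>E\<close> and, with
  \<open>H = E\<close>, for a finite graph on its own.\<close>

lemma compactin_infinite_paths:
  assumes H: "subgraph H E" and fin: "finite (arcs H)"
  shows "compactin (path_topology E) (infinite_paths H)"
proof -
  let ?D = "discrete_topology (arcs H)"
  let ?P = "product_topology (\<lambda>_::nat. ?D) UNIV"
  define C where "C = (\<Inter>i. {f \<in> topspace ?P. tail H (f (Suc i)) = head H (f i)})"
  \<comment> \<open>Source and range of the \<open>i\<close>-th edge depend continuously on
    \<open>f\<close>, as every map out of a discrete space is continuous. Each condition in
    \<open>C\<close> is thus an equalizer of maps into a Hausdorff space, hence closed.\<close>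
  have proj: "continuous_map ?P (discrete_topology UNIV) (\<lambda>f. h (f i))"
    for h :: "'b \<Rightarrow> 'a" and i
  proof -
    have "continuous_map ?P ?D (\<lambda>f. f i)"
      by (rule continuous_map_product_projection) simp
    moreover have "continuous_map ?D (discrete_topology UNIV) h" by simp
    ultimately have "continuous_map ?P (discrete_topology UNIV) (h \<circ> (\<lambda>f. f i))"
      by (rule continuous_map_compose)
    then show ?thesis by (simp add: o_def)
  qed
  have "closedin ?P C"
    unfolding C_def
    by (intro closedin_INT)
       (auto simp del: topspace_product_topology
          intro: closedin_continuous_maps_eq[OF Hausdorff_space_discrete_topology proj proj])
  moreover have "compact_space ?P"
    using fin by (simp add: compact_space_product_topology compact_space_discrete_topology)
  ultimately have "compactin ?P C"
    by (rule closedin_compact_space[rotated])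
  then have comp: "compactin (subtopology ?P C) C"
    by (simp add: compactin_subtopology)
  have smapC: "(\<lambda>f. smap f nats) ` C = infinite_paths H"
  proof (intro equalityI subsetI)
    fix x assume "x \<in> infinite_paths H"
    then have "snth x \<in> C" by (auto simp: C_def infinite_paths_iff)
    moreover have "x = smap (snth x) nats" by (simp add: stream_smap_nats)
    ultimately show "x \<in> (\<lambda>f. smap f nats) ` C" by blast
  qed (auto simp: C_def infinite_paths_iff PiE_iff)
  have "continuous_map (subtopology ?P C) (path_topology E) (\<lambda>f. smap f nats)"
    unfolding path_topology_def
  proof (rule continuous_on_generated_topo)
    fix U assume "U \<in> cylinder E ` finite_paths E"
    then obtain b where b: "U = cylinder E b" by blast
    \<comment> \<open>A cylinder constrains only the first \<open>length b\<close> edges, so within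
      \<open>C\<close> its preimage is a finite intersection of open coordinate conditions.\<close>
    let ?W = "topspace ?P \<inter> (\<Inter>i\<in>{..<length b}. {f \<in> topspace ?P. f i \<in> {b ! i} \<inter> arcs H})"
    have "openin ?P {f \<in> topspace ?P. f i \<in> {b ! i} \<inter> arcs H}" for i
      by (rule openin_continuous_map_preimage[of _ ?D])
         (auto intro: continuous_map_product_projection)
    then have "openin ?P ?W" by (intro openin_Int_Inter finite_imageI openin_topspace) auto
    moreover have "(\<lambda>f. smap f nats) -` U \<inter> C = ?W \<inter> C"
    proof -
      have "smap f nats \<in> infinite_paths E" if "f \<in> C" for f
        using infinite_paths_subgraph[OF H] smapC that by blast
      then show ?thesis
        unfolding b cylinder_eq by (auto simp: list_eq_iff_nth_eq C_def PiE_iff)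
    qed
    moreover have "C \<subseteq> topspace ?P" by (auto simp: C_def)
    ultimately show "openin (subtopology ?P C) ((\<lambda>f. smap f nats) -` U \<inter> topspace (subtopology ?P C))"
      by (auto simp: openin_subtopology Int_absorb1)
  next
    have "infinite_paths E = \<Union> (cylinder E ` finite_paths E)"
      using topspace_path_topology[of E] unfolding path_topology_def by simp
    then show "(\<lambda>f. smap f nats) ` topspace (subtopology ?P C) \<subseteq> \<Union> (cylinder E ` finite_paths E)"
      using infinite_paths_subgraph[OF H] smapC by auto
  qed
  from image_compactin[OF comp this] show ?thesis
    by (simp add: smapC)
qed

section \<open>Topological entropy of a finite graph\<close>

text \<open>Words are prefixes of infinite paths rather than arbitrary finite paths: a subgraph may
  have sinks even if the ambient graph has none, and words that cannot be continued do not count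
  towards its entropy.\<close>

definition path_words :: "('v, 'e) pre_digraph \<Rightarrow> nat \<Rightarrow> 'e list set" where
  "path_words E n = stake n ` infinite_paths E"

lemma finite_path_words:
  assumes "finite (arcs E)"
  shows "finite (path_words E n)"
proof (rule finite_subset)
  show "path_words E n \<subseteq> {b. set b \<subseteq> arcs E \<and> length b = n}"
    by (auto simp: path_words_def infinite_paths_iff in_set_conv_nth)
qed (rule finite_lists_length_eq[OF assms])

section \<open>Minimal subcovers and the number of path words\<close>

lemma finite_iterated_join:
  assumes "finite \<U>"
  shows "finite (iterated_join T f n \<U>)"
proof (rule finite_subset)
  let ?J = "\<lambda>u. {x \<in> topspace T. \<forall>i<n. (f ^^ i) x \<in> u i}"
  \<comment> \<open>The values of \<open>u\<close> from \<open>n\<close> on do not affect the set,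
    so \<open>u\<close> may be taken from a finite space of extensional functions.\<close>
  have *: "\<exists>v\<in>{..<n} \<rightarrow>\<^sub>E \<U>. ?J u = ?J v" if "\<forall>i<n. u i \<in> \<U>" for u
    using that by (intro bexI[of _ "restrict u {..<n}"]) auto
  show "iterated_join T f n \<U> \<subseteq> ?J ` ({..<n} \<rightarrow>\<^sub>E \<U>)"
  proof (intro subsetI)
    fix V assume "V \<in> iterated_join T f n \<U>"
    then obtain u where "V = ?J u" "\<forall>i<n. u i \<in> \<U>"
      unfolding iterated_join_def by (elim CollectE exE conjE)
    moreover from *[OF this(2)] obtain v where "v \<in> {..<n} \<rightarrow>\<^sub>E \<U>" "?J u = ?J v" ..
    ultimately show "V \<in> ?J ` ({..<n} \<rightarrow>\<^sub>E \<U>)" by (simp only: image_eqI)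
  qed
  show "finite (?J ` ({..<n} \<rightarrow>\<^sub>E \<U>))"
    using assms by (intro finite_imageI finite_PiE) auto
qed

lemma Union_iterated_join_stl:
  assumes "open_cover (path_topology E) \<U>"
  shows "\<Union>(iterated_join (path_topology E) stl n \<U>) = infinite_paths E"
proof (intro equalityI subsetI)
  fix x assume x: "x \<in> infinite_paths E"
  then have "\<exists>U\<in>\<U>. sdrop i x \<in> U" for i
    using assms sdrop_infinite_paths[OF x, of i] unfolding open_cover_def topspace_path_topology
    by blast
  then obtain u where "\<And>i. u i \<in> \<U>" "\<And>i. sdrop i x \<in> u i" by metis
  with x show "x \<in> \<Union>(iterated_join (path_topology E) stl n \<U>)"
    unfolding iterated_join_def
    by (intro UnionI[of "{x \<in> infinite_paths E. \<forall>i<n. sdrop i x \<in> u i}"]) (auto simp: funpow_stl)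
qed (auto simp: iterated_join_def)

text \<open>A partition into open pieces, some possibly empty. Its \<open>n\<close>-fold join sorts
  paths by their first \<open>n\<close> edges, which makes it the cover from which lower bounds on
  the entropy are read off.\<close>

definition first_edge_cover :: "('v, 'e) pre_digraph \<Rightarrow> 'e stream set set" where
  "first_edge_cover E = (\<lambda>e. {x \<in> infinite_paths E. shd x = e}) ` arcs E"

lemma open_cover_first_edge_cover: "open_cover (path_topology E) (first_edge_cover E)"
proof -
  have "openin (path_topology E) {x \<in> infinite_paths E. shd x = e}" for e
  proof (cases "\<exists>x\<in>infinite_paths E. shd x = e")
    case True
    then obtain x where x: "x \<in> infinite_paths E" "shd x = e" by blast
    then have "{x \<in> infinite_paths E. shd x = e} = {y \<in> infinite_paths E. stake 1 y = stake 1 x}"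
      by auto
    then show ?thesis using openin_prefix[OF x(1), of 1] by (simp only:)
  next
    case False
    then have "{x \<in> infinite_paths E. shd x = e} = {}" by auto
    then show ?thesis by (simp only: openin_empty)
  qed
  moreover have "shd x \<in> arcs E" if "x \<in> infinite_paths E" for x
    using that[unfolded infinite_paths_iff, THEN spec, of 0] by simp
  ultimately show ?thesis
    unfolding open_cover_def first_edge_cover_def by auto
qed

text \<open>All paths in one member of the join share their first \<open>n\<close> edges, so every
  subcover has at least one member for each word.\<close>

lemma card_path_words_le_min_subcover_card:
  assumes "finite (arcs E)"
  shows "card (path_words E n)
    \<le> min_subcover_card (path_topology E) (iterated_join (path_topology E) stl n (first_edge_cover E))"
    (is "_ \<le> min_subcover_card _ ?J")
proof -
  \<comment> \<open>The \<open>LEAST\<close> in \<open>min_subcover_card\<close> carries information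
    only once some finite subcover exists; the whole join is one.\<close>
  have "finite ?J"
    using assms by (intro finite_iterated_join) (simp add: first_edge_cover_def)
  moreover have "\<Union>?J = infinite_paths E"
    by (rule Union_iterated_join_stl[OF open_cover_first_edge_cover])
  ultimately have "\<exists>k. \<exists>\<V>\<subseteq>?J. finite \<V> \<and> card \<V> = k \<and> \<Union>\<V> = topspace (path_topology E)"
    by auto
  from LeastI_ex[OF this] obtain \<V> where V: "\<V> \<subseteq> ?J" "finite \<V>"
    "card \<V> = min_subcover_card (path_topology E) ?J" "\<Union>\<V> = infinite_paths E"
    unfolding min_subcover_card_def by auto
  have "path_words E n \<subseteq> (\<lambda>V. stake n (SOME x. x \<in> V)) ` \<V>"
  proof
    fix w assume "w \<in> path_words E n"
    then obtain x where x: "x \<in> infinite_paths E" "w = stake n x" by (auto simp: path_words_def)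
    with V obtain V where W: "V \<in> \<V>" "x \<in> V" by blast
    have "stake n y = stake n x" if "y \<in> V" for y
    proof -
      from W V(1) have "V \<in> ?J" by blast
      then obtain u where u: "V = {x \<in> infinite_paths E. \<forall>i<n. sdrop i x \<in> u i}"
        "\<forall>i<n. u i \<in> first_edge_cover E"
        by (auto simp: iterated_join_def funpow_stl)
      have "y !! i = x !! i" if i: "i < n" for i
      proof -
        obtain e where "u i = {x \<in> infinite_paths E. shd x = e}"
          using u(2) i by (auto simp: first_edge_cover_def)
        moreover have "sdrop i x \<in> u i" "sdrop i y \<in> u i"
          using W(2) \<open>y \<in> V\<close> u(1) i by auto
        ultimately show ?thesis by simp
      qed
      then show ?thesis by (simp add: stake_eq_iff)
    qed
    from this[OF someI[of "\<lambda>x. x \<in> V", OF W(2)]] x(2)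
    have "w = stake n (SOME x. x \<in> V)" by simp
    then show "w \<in> (\<lambda>V. stake n (SOME x. x \<in> V)) ` \<V>"
      using W(1) by (rule image_eqI)
  qed
  then show ?thesis
    using surj_card_le[OF V(2)] V(3) by simp
qed

text \<open>The Lebesgue number of a cover, expressed as a prefix length: by compactness finitely
  many prefix sets inside members of the cover suffice, and a prefix at least as long as all of
  theirs stays inside one of them.\<close>

lemma Lebesgue_prefix_length:
  assumes "compactin (path_topology E) (infinite_paths E)" "open_cover (path_topology E) \<U>"
  shows "\<exists>L>0. \<forall>x\<in>infinite_paths E. \<exists>U\<in>\<U>. {y \<in> infinite_paths E. stake L y = stake L x} \<subseteq> U"
proof -
  let ?B = "\<lambda>n x. {y \<in> infinite_paths E. stake n y = stake n x}"
  have "\<forall>x\<in>infinite_paths E. \<exists>m. m > 0 \<and> (\<exists>U\<in>\<U>. ?B m x \<subseteq> U)"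
  proof
    fix x assume "x \<in> infinite_paths E"
    with assms(2) obtain U where U: "U \<in> \<U>" "openin (path_topology E) U" "x \<in> U"
      unfolding open_cover_def topspace_path_topology by blast
    from openin_path_topology_prefix[OF U(2,3)] obtain m where "m > 0 \<and> ?B m x \<subseteq> U" ..
    with U(1) show "\<exists>m. m > 0 \<and> (\<exists>U\<in>\<U>. ?B m x \<subseteq> U)" by (intro exI[of _ m]) auto
  qed
  from bchoice[OF this] obtain m
    where m: "\<forall>x\<in>infinite_paths E. m x > 0 \<and> (\<exists>U\<in>\<U>. ?B (m x) x \<subseteq> U)" ..
  let ?C = "(\<lambda>x. ?B (m x) x) ` infinite_paths E"
  have "\<forall>B\<in>?C. openin (path_topology E) B" using m by (auto intro: openin_prefix)
  moreover have "infinite_paths E \<subseteq> \<Union>?C" by auto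
  ultimately obtain \<F> where F: "finite \<F>" "\<F> \<subseteq> ?C" "infinite_paths E \<subseteq> \<Union>\<F>"
    using assms(1) unfolding compactin_def by meson
  then obtain S where S: "finite S" "S \<subseteq> infinite_paths E" "\<F> = (\<lambda>x. ?B (m x) x) ` S"
    by (meson finite_subset_image)
  \<comment> \<open>The sum is a common upper bound of the lengths \<open>m x\<close>, and the
    successor makes it positive even if \<open>S\<close> is empty.\<close>
  define L where "L = Suc (\<Sum>x\<in>S. m x)"
  have "\<exists>U\<in>\<U>. ?B L x \<subseteq> U" if x: "x \<in> infinite_paths E" for x
  proof -
    from x F S obtain z where z: "z \<in> S" "x \<in> ?B (m z) z" by blast
    have "m z \<le> L" using z(1) S(1) by (auto simp: L_def intro!: le_SucI member_le_sum)
    then have "?B L x \<subseteq> ?B (m z) z" using z(2) by (auto dest: stake_eq_mono)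
    moreover obtain U where "U \<in> \<U>" "?B (m z) z \<subseteq> U" using m z(1) S(2) by blast
    ultimately show ?thesis by (intro bexI[of _ U]) simp_all
  qed
  then show ?thesis by (intro exI[of _ L]) (auto simp: L_def)
qed

text \<open>A word of length \<open>n + L\<close> determines the windows of length \<open>L\<close>
  at all positions below \<open>n\<close>, hence a member of the cover for each of these shifts and
  so a member of the join. One member per word gives a subcover.\<close>

lemma min_subcover_card_le_card_path_words:
  assumes "finite (arcs E)" "wf_digraph E" "open_cover (path_topology E) \<U>"
  shows "\<exists>L>0. \<forall>n. min_subcover_card (path_topology E) (iterated_join (path_topology E) stl n \<U>)
                   \<le> card (path_words E (n + L))"
proof -
  have "compactin (path_topology E) (infinite_paths E)"
    using assms by (intro compactin_infinite_paths) (auto simp: subgraph_def compatible_def)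
  from Lebesgue_prefix_length[OF this assms(3)] obtain L where L: "L > 0"
    "\<And>x. x \<in> infinite_paths E \<Longrightarrow> \<exists>U\<in>\<U>. {y \<in> infinite_paths E. stake L y = stake L x} \<subseteq> U"
    by blast
  have "min_subcover_card (path_topology E) (iterated_join (path_topology E) stl n \<U>)
          \<le> card (path_words E (n + L))" (is "min_subcover_card _ ?J \<le> _") for n
  proof -
    have "\<forall>x\<in>infinite_paths E. \<exists>V.
      V \<in> ?J \<and> {y \<in> infinite_paths E. stake (n + L) y = stake (n + L) x} \<subseteq> V"
    proof
      fix x assume x: "x \<in> infinite_paths E"
      have "\<forall>i. \<exists>U. U \<in> \<U> \<and> {y \<in> infinite_paths E. stake L y = stake L (sdrop i x)} \<subseteq> U"
        using L(2) sdrop_infinite_paths[OF x] by blast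
      from choice[OF this] obtain u where u: "\<forall>i. u i \<in> \<U> \<and>
        {y \<in> infinite_paths E. stake L y = stake L (sdrop i x)} \<subseteq> u i" ..
      have "sdrop i y \<in> u i"
        if "y \<in> infinite_paths E" "stake (n + L) y = stake (n + L) x" "i < n" for y i
        using that u[THEN spec, of i] sdrop_infinite_paths[of y E i]
        by (auto simp: stake_eq_iff sdrop_snth)
      with u show "\<exists>V. V \<in> ?J \<and>
          {y \<in> infinite_paths E. stake (n + L) y = stake (n + L) x} \<subseteq> V"
        by (intro exI[of _ "{x \<in> infinite_paths E. \<forall>i<n. sdrop i x \<in> u i}"])
           (auto simp: iterated_join_def funpow_stl)
    qed
    from bchoice[OF this] obtain V where V: "\<forall>x\<in>infinite_paths E.
      V x \<in> ?J \<and> {y \<in> infinite_paths E. stake (n + L) y = stake (n + L) x} \<subseteq> V x" ..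
    \<comment> \<open>\<open>r w\<close> is an infinite path that starts with \<open>w\<close>;
      every path with that prefix lies in the member chosen for \<open>r w\<close>.\<close>
    define r where "r = inv_into (infinite_paths E) (stake (n + L))"
    have r: "r w \<in> infinite_paths E" "stake (n + L) (r w) = w" if "w \<in> path_words E (n + L)" for w
      using that unfolding r_def path_words_def by (auto intro: inv_into_into f_inv_into_f)
    let ?V = "(V \<circ> r) ` path_words E (n + L)"
    have "?V \<subseteq> ?J" using V r(1) by auto
    moreover have "\<Union>?V = infinite_paths E"
    proof (intro equalityI subsetI)
      fix y assume y: "y \<in> infinite_paths E"
      then have w: "stake (n + L) y \<in> path_words E (n + L)" by (simp add: path_words_def)
      then have "y \<in> V (r (stake (n + L) y))" 
        using y r(2)[OF w] V[THEN bspec, OF r(1)[OF w]] by (simp add: subset_iff)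
      with w show "y \<in> \<Union>?V" by auto
    qed (use V r(1) in \<open>auto simp: iterated_join_def\<close>)
    moreover have "finite ?V" using finite_path_words[OF assms(1)] by blast
    ultimately have "min_subcover_card (path_topology E) ?J \<le> card ?V"
      unfolding min_subcover_card_def by (intro Least_le) auto
    also have "\<dots> \<le> card (path_words E (n + L))"
      using finite_path_words[OF assms(1)] by (rule card_image_le)
    finally show ?thesis .
  qed
  with L(1) show ?thesis by blast
qed

section \<open>Closed paths\<close>

lemma ln_of_nat_nonneg: "0 \<le> ln (real n)"
  by (cases n) simp_all

lemma ln_of_nat_mono: "m \<le> n \<Longrightarrow> ln (real m) \<le> ln (real n)"
  using ln_of_nat_nonneg[of n] by (cases m) simp_all

text \<open>The end vertex is read off as the source of the edge after the word, so a closed path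
  comes with an infinite continuation. Nothing is lost for \<open>l > 0\<close>, since a closed path
  can be repeated forever; for \<open>l = 0\<close> only \<open>[]\<close> can occur.\<close>

definition closed_paths :: "('v, 'e) pre_digraph \<Rightarrow> 'v \<Rightarrow> nat \<Rightarrow> 'e list set" where
  "closed_paths E v l =
     stake l ` {x \<in> infinite_paths E. tail E (x !! 0) = v \<and> tail E (x !! l) = v}"

lemma finite_out_arcs:
  assumes "wf_digraph E" "row_finite E"
  shows "finite (out_arcs E v)"
proof (cases "v \<in> verts E")
  case True
  then show ?thesis using assms(2) by (simp add: row_finite_def)
next
  case False
  then have "out_arcs E v = {}"
    using wf_digraph.tail_in_verts[OF assms(1)] by auto
  then show ?thesis by simp
qed

lemma finite_prefixes_from:
  assumes "wf_digraph E" "row_finite E"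
  shows "finite (stake n ` {x \<in> infinite_paths E. tail E (x !! 0) = v})"
proof (induction n arbitrary: v)
  case 0
  have "stake 0 ` X \<subseteq> {[]}" for X :: "'b stream set" by auto
  then show ?case by (rule finite_subset) simp
next
  case (Suc n)
  let ?P = "\<lambda>v. {x \<in> infinite_paths E. tail E (x !! 0) = v}"
  have "stake (Suc n) ` ?P v \<subseteq> (\<Union>e\<in>out_arcs E v. (#) e ` stake n ` ?P (head E e))"
  proof
    fix b assume "b \<in> stake (Suc n) ` ?P v"
    then obtain x where x: "x \<in> infinite_paths E" "tail E (x !! 0) = v" "b = stake (Suc n) x" by blast
    then have "x !! 0 \<in> out_arcs E v" "tail E (x !! Suc 0) = head E (x !! 0)"
      by (simp_all add: infinite_paths_iff del: snth.simps)
    then have "stl x \<in> ?P (head E (shd x))" "shd x \<in> out_arcs E v"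
      using stl_infinite_paths[OF x(1)] by simp_all
    with x(3) show "b \<in> (\<Union>e\<in>out_arcs E v. (#) e ` stake n ` ?P (head E e))"
      by (intro UN_I[of "shd x"]) simp_all
  qed
  then show ?case
    by (rule finite_subset) (use Suc.IH finite_out_arcs[OF assms] in blast)
qed

lemma finite_closed_paths:
  assumes "wf_digraph E" "row_finite E"
  shows "finite (closed_paths E v l)"
  by (rule finite_subset[OF _ finite_prefixes_from[OF assms, of l v]])
     (auto simp: closed_paths_def)

text \<open>Entropy is an upper limit, so growth along the positive multiples of \<open>l\<close>
  already bounds it from below; at these lengths the concatenations of closed paths are
  counted.\<close>

lemma topological_entropy_ge:
  assumes "finite (arcs H)" "l > 0"
    and growth: "\<And>m. m > 0 \<Longrightarrow> a * real (m * l) \<le> ln (real (card (path_words H (m * l))))"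
  shows "ennreal a \<le> topological_entropy (path_topology H) stl"
proof -
  let ?M = "\<lambda>n. min_subcover_card (path_topology H)
                  (iterated_join (path_topology H) stl n (first_edge_cover H))"
  let ?f = "\<lambda>n. ennreal (ln (real (?M n)) / real n)"
  have "a \<le> ln (real (?M (Suc m * l))) / real (Suc m * l)" for m
  proof -
    have "a * real (Suc m * l) \<le> ln (real (card (path_words H (Suc m * l))))"
      by (rule growth) simp
    also have "\<dots> \<le> ln (real (?M (Suc m * l)))"
      by (intro ln_of_nat_mono card_path_words_le_min_subcover_card assms(1))
    finally show ?thesis
      using assms(2) by (subst pos_le_divide_eq) (simp_all del: mult_Suc of_nat_mult)
  qed
  then have "ennreal a \<le> limsup (?f \<circ> (\<lambda>m. Suc m * l))"
    by (intro le_Limsup) (auto intro!: always_eventually ennreal_leI simp del: mult_Suc of_nat_mult)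
  also have "\<dots> \<le> limsup ?f"
    using assms(2) by (intro limsup_subseq_mono) (auto simp: strict_mono_def)
  also have "\<dots> \<le> topological_entropy (path_topology H) stl"
    unfolding topological_entropy_def
    by (rule SUP_upper) (simp add: open_cover_first_edge_cover)
  finally show ?thesis .
qed

text \<open>The seam fits because the path behind \<open>b\<close> returns to \<open>v\<close> at
  time \<open>l\<close>, so its last edge before that time has range \<open>v\<close>, where
  \<open>y\<close> starts.\<close>

lemma shift_closed_path:
  assumes b: "b \<in> closed_paths E v l" and H: "subgraph H E" and "set b \<subseteq> arcs H"
    and y: "y \<in> infinite_paths H" "tail E (y !! 0) = v"
  shows "b @- y \<in> infinite_paths H" "tail E ((b @- y) !! 0) = v"
proof -
  obtain x where x: "x \<in> infinite_paths E" "tail E (x !! 0) = v" "tail E (x !! l) = v" "b = stake l x"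
    using b by (auto simp: closed_paths_def)
  have tail: "tail H = tail E" "head H = head E"
    using H by (auto simp: subgraph_def compatible_def)
  have arc: "x !! i \<in> arcs H" if "i < l" for i
    using assms(3) that by (auto simp: x(4) set_conv_nth)
  have step: "tail E (x !! Suc i) = head E (x !! i)" for i
    using x(1) by (simp add: infinite_paths_iff)
  have nth: "(b @- y) !! i = (if i < l then x !! i else y !! (i - l))" for i
    by (simp add: x(4) shift_snth)
  show "b @- y \<in> infinite_paths H"
    unfolding infinite_paths_iff
  proof (intro allI conjI)
    fix i
    show "(b @- y) !! i \<in> arcs H"
      using y(1) by (simp add: nth arc infinite_paths_iff)
    consider "Suc i < l" | "Suc i = l" | "l \<le> i" by linarith
    then show "tail H ((b @- y) !! Suc i) = head H ((b @- y) !! i)"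
    proof cases
      case 2
      then show ?thesis using step[of i] x(3) y(2) by (auto simp: nth tail simp del: snth.simps)
    next
      case 3
      then show ?thesis using y(1) by (simp add: nth infinite_paths_iff Suc_diff_le del: snth.simps)
    qed (simp add: nth tail step del: snth.simps)
  qed
  show "tail E ((b @- y) !! 0) = v"
    using x(2) y(2) by (simp add: nth del: snth.simps)
qed

text \<open>Starts the induction on the number of concatenated closed paths: words are counted only
  as prefixes of infinite paths, and going around \<open>b\<close> forever supplies one.\<close>

lemma cycle_closed_path:
  assumes b: "b \<in> closed_paths E v l" and H: "subgraph H E" and "set b \<subseteq> arcs H" and "l > 0"
  shows "cycle b \<in> infinite_paths H" "tail E (cycle b !! 0) = v"
proof -
  obtain x where x: "x \<in> infinite_paths E" "tail E (x !! 0) = v" "tail E (x !! l) = v" "b = stake l x"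
    using b by (auto simp: closed_paths_def)
  have tail: "tail H = tail E" "head H = head E"
    using H by (auto simp: subgraph_def compatible_def)
  have arc: "x !! i \<in> arcs H" if "i < l" for i
    using assms(3) that by (auto simp: x(4) set_conv_nth)
  have step: "tail E (x !! Suc i) = head E (x !! i)" for i
    using x(1) by (simp add: infinite_paths_iff)
  have ne: "b \<noteq> []" using \<open>l > 0\<close> x(4) by auto
  have nth: "cycle b !! i = x !! (i mod l)" for i
  proof -
    have "cycle b !! i = shd (sdrop i (cycle b))" by simp
    also have "\<dots> = hd (rotate (i mod length b) b)"
      using ne by (simp add: sdrop_cycle del: sdrop_simps)
    also have "\<dots> = b ! (i mod l)"
      using ne by (subst hd_rotate_conv_nth) (simp_all add: x(4))
    finally show ?thesis using \<open>l > 0\<close> by (simp add: x(4))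
  qed
  show "cycle b \<in> infinite_paths H"
    unfolding infinite_paths_iff nth
  proof (intro allI conjI)
    fix i
    show "x !! (i mod l) \<in> arcs H" using arc \<open>l > 0\<close> by simp
    show "tail H (x !! (Suc i mod l)) = head H (x !! (i mod l))"
      using step[of "i mod l"] x(2,3) by (auto simp: tail mod_Suc simp del: snth.simps)
  qed
  show "tail E (cycle b !! 0) = v" unfolding nth using x(2) by simp
qed

text \<open>The edges of the closed paths of length \<open>l\<close> at \<open>v\<close> form a
  finite strongly connected subgraph \<open>H\<close>. Any \<open>m\<close> of these closed paths
  can be concatenated in \<open>H\<close>, so \<open>H\<close> has at least
  \<open>card C ^ m\<close> words of length \<open>m * l\<close> and entropy at least
  \<open>ln (card C) / l\<close>, which is at most \<open>h\<close>.\<close>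

lemma card_closed_paths_le:
  assumes E: "wf_digraph E" "row_finite E" and h: "gurevich_entropy E = ennreal h" "h \<ge> 0"
  shows "real (card (closed_paths E v l)) \<le> exp (h * real l)"
proof (cases "l = 0 \<or> closed_paths E v l = {}")
  \<comment> \<open>The general argument divides by \<open>l\<close> and picks an element of
    \<open>C\<close>; here there is at most the empty word.\<close>
  case True
  then have "closed_paths E v l \<subseteq> {[]}" by (auto simp: closed_paths_def)
  then have "card (closed_paths E v l) \<le> card {[] :: 'b list}" by (rule card_mono[rotated]) simp
  then have "real (card (closed_paths E v l)) \<le> 1" by simp
  also have "1 \<le> exp (h * real l)" using h(2) by simp
  finally show ?thesis .
next
  case False
  define C where "C = closed_paths E v l"
  define A where "A = \<Union>(set ` C)"
  define H where "H = \<lparr>verts = tail E ` A \<union> head E ` A, arcs = A, tail = tail E, head = head E\<rparr>"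
  have l: "l > 0" and C: "C \<noteq> {}" "finite C"
    using False finite_closed_paths[OF E] by (auto simp: C_def)
  have AE: "A \<subseteq> arcs E"
    by (auto simp: A_def C_def closed_paths_def infinite_paths_iff set_conv_nth)
  have finA: "finite A" unfolding A_def using C by blast
  have wfH: "wf_digraph H" by unfold_locales (auto simp: H_def)
  have sub: "subgraph H E"
    using E(1) AE wfH wf_digraph.head_in_verts[OF E(1)] wf_digraph.tail_in_verts[OF E(1)]
    unfolding subgraph_def compatible_def by (auto simp: H_def)
  have finH: "fin_digraph H"
    using wfH finA by (auto simp: fin_digraph_def fin_digraph_axioms_def H_def)
  have vert: "v \<in> verts H"
  proof -
    obtain b where b: "b \<in> C" using C by blast
    then obtain x where "tail E (x !! 0) = v" "b = stake l x" by (auto simp: C_def closed_paths_def)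
    then have "x !! 0 \<in> set b" using l nth_mem[of 0 b] by simp
    then have "x !! 0 \<in> A" using b by (auto simp: A_def)
    then show ?thesis using \<open>tail E (x !! 0) = v\<close> by (auto simp: H_def)
  qed
  interpret H: wf_digraph H by (rule wfH)
  \<comment> \<open>Some closed path visits \<open>u\<close> at a time \<open>j \<le> l\<close>; its
    part before \<open>j\<close> leads from \<open>v\<close> to \<open>u\<close>, the rest back to
    \<open>v\<close>.\<close>
  have reach: "v \<rightarrow>\<^sup>*\<^bsub>H\<^esub> u \<and> u \<rightarrow>\<^sup>*\<^bsub>H\<^esub> v" if u: "u \<in> verts H" for u
  proof -
    obtain e where e: "e \<in> A" "u = tail E e \<or> u = head E e"
      using u by (auto simp: H_def)
    obtain b where "b \<in> C" "e \<in> set b" using e(1) by (auto simp: A_def)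
    moreover from this obtain x where x: "x \<in> infinite_paths E" "tail E (x !! 0) = v"
      "tail E (x !! l) = v" "b = stake l x" by (auto simp: C_def closed_paths_def)
    ultimately obtain i where i: "i < l" "e = x !! i"
      by (auto simp: set_conv_nth)
    have A: "x !! j \<in> A" if "j < l" for j
      using that \<open>b \<in> C\<close> nth_mem[of j b] x(4) by (auto simp: A_def)
    have step: "tail E (x !! Suc j) = head E (x !! j)" for j
      using x(1) by (simp add: infinite_paths_iff)
    have adj: "tail E (x !! j) \<rightarrow>\<^bsub>H\<^esub> tail E (x !! Suc j)" if "j < l" for j
      using H.in_arcs_imp_in_arcs_ends[of "x !! j"] A[OF that] by (simp add: step H_def del: snth.simps)
    have to: "v \<rightarrow>\<^sup>*\<^bsub>H\<^esub> tail E (x !! j)" if "j \<le> l" for j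
      using that
    proof (induction j)
      case 0
      then show ?case using vert by (simp only: x(2) H.reachable_refl)
    next
      case (Suc j)
      then show ?case using H.reachable_adj_trans adj[of j] by simp
    qed
    have from_: "tail E (x !! j) \<rightarrow>\<^sup>*\<^bsub>H\<^esub> v" if "j \<le> l" for j
      using that
    proof (induction j rule: inc_induct)
      case base
      then show ?case using vert by (simp only: x(3) H.reachable_refl)
    next
      case (step j)
      then show ?case using H.adj_reachable_trans[OF adj[of j]] by simp
    qed
    obtain j where "j \<le> l" "u = tail E (x !! j)"
      using e(2) i step[of i] by (metis Suc_leI less_imp_le)
    then show ?thesis using to from_ by simp
  qed
  have "strongly_connected (mk_symmetric H)"
  proof (rule strongly_connectedI)
    fix u w assume "u \<in> verts (mk_symmetric H)" "w \<in> verts (mk_symmetric H)"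
    then have "u \<rightarrow>\<^sup>*\<^bsub>H\<^esub> w" using reach H.reachable_trans by (metis pverts_mk_symmetric with_proj_simps(1))
    then show "u \<rightarrow>\<^sup>*\<^bsub>mk_symmetric H\<^esub> w" by (rule H.reachable_mk_symmetricI)
  qed (use vert in auto)
  then have conn: "Digraph_Component.connected H" by (simp add: Digraph_Component.connected_def)
  \<comment> \<open>The words counted are anchored at \<open>v\<close>, so that a further closed
    path can be put in front.\<close>
  let ?S = "\<lambda>m. stake (m * l) ` {x \<in> infinite_paths H. tail E (x !! 0) = v}"
  have arcsH: "set b \<subseteq> arcs H" if "b \<in> C" for b
    using that by (auto simp: H_def A_def)
  have fin_S: "finite (?S m)" for m
    by (rule finite_subset[OF _ finite_path_words[of H "m * l"]]) (auto simp: path_words_def H_def finA)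
  have card_S: "card C ^ m \<le> card (?S m)" for m
  proof (induction m)
    case 0
    \<comment> \<open>\<open>?S 0\<close> would be empty if no infinite path of \<open>H\<close>
      started at \<open>v\<close>; the periodic path rules this out.\<close>
    obtain b where "b \<in> C" using C by blast
    then have "cycle b \<in> {x \<in> infinite_paths H. tail E (x !! 0) = v}"
      using cycle_closed_path[OF _ sub arcsH l] C_def by simp
    then have "?S 0 \<noteq> {}" by blast
    then have "card (?S 0) > 0" using fin_S[of 0] by (simp only: card_gt_0_iff simp_thms)
    then show ?case by simp
  next
    case (Suc m)
    \<comment> \<open>All elements of \<open>C\<close> have length \<open>l\<close>, so a
      concatenation determines its two parts.\<close>
    have "inj_on (\<lambda>(b, w). b @ w) (C \<times> ?S m)"
      by (auto simp: inj_on_def C_def closed_paths_def)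
    then have "card (C \<times> ?S m) = card ((\<lambda>(b, w). b @ w) ` (C \<times> ?S m))"
      by (simp add: card_image)
    also have "\<dots> \<le> card (?S (Suc m))"
    proof (intro card_mono fin_S subsetI)
      fix z assume "z \<in> (\<lambda>(b, w). b @ w) ` (C \<times> ?S m)"
      then obtain b y where bz: "b \<in> C" "y \<in> infinite_paths H" "tail E (y !! 0) = v"
        "z = b @ stake (m * l) y" by auto
      then have "length b = l" by (auto simp: C_def closed_paths_def)
      then have "z = stake (Suc m * l) (b @- y)" by (simp add: bz(4) stake_shift)
      moreover have "b @- y \<in> {x \<in> infinite_paths H. tail E (x !! 0) = v}"
        using shift_closed_path[OF _ sub arcsH bz(2,3), of b l] bz(1) C_def by simp
      ultimately show "z \<in> ?S (Suc m)" by (rule image_eqI)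
    qed
    finally show ?case
      using Suc.IH by (simp add: card_cartesian_product) (meson mult_le_mono2 order_trans)
  qed
  have pos: "card C > 0" using C by (simp add: card_gt_0_iff)
  have "ennreal (ln (card C) / l) \<le> topological_entropy (path_topology H) stl"
  proof (rule topological_entropy_ge)
    fix m :: nat
    have "card C ^ m \<le> card (path_words H (m * l))"
      by (rule order_trans[OF card_S card_mono])
         (auto simp: path_words_def[symmetric] finite_path_words H_def finA, auto simp: path_words_def)
    then have "ln (real (card C ^ m)) \<le> ln (real (card (path_words H (m * l))))"
      by (rule ln_of_nat_mono)
    then show "ln (card C) / l * real (m * l) \<le> ln (real (card (path_words H (m * l))))"
      using l pos by (simp add: ln_realpow mult.commute)
  qed (use finA l in \<open>auto simp: H_def\<close>)
  also have "\<dots> \<le> gurevich_entropy E"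
    unfolding gurevich_entropy_def
    by (rule SUP_upper) (use sub finH conn in blast)
  finally have "ln (card C) / l \<le> h"
    using h by (simp add: ennreal_le_iff)
  then have "ln (card C) \<le> h * l" using l by (simp add: field_simps)
  then show ?thesis using pos by (simp add: C_def[symmetric] flip: exp_le_cancel_iff[of "ln _"])
qed

section \<open>Counting itineraries\<close>

definition itinerary :: "('v, 'e) pre_digraph \<Rightarrow> 'v set \<Rightarrow> 'e list \<Rightarrow> 'e option list" where
  "itinerary E S = map (\<lambda>e. if tail E e \<in> S then Some e else None)"

definition itineraries :: "('v, 'e) pre_digraph \<Rightarrow> 'v set \<Rightarrow> nat \<Rightarrow> 'e option list set" where
  "itineraries E S n = itinerary E S ` path_words E n"

lemma itinerary_append [simp]: "itinerary E S (b @ c) = itinerary E S b @ itinerary E S c"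
  by (simp add: itinerary_def)

lemma itinerary_insert:
  assumes "\<forall>e\<in>set b. tail E e \<noteq> v"
  shows "itinerary E (insert v S) b = itinerary E S b"
  using assms by (simp add: itinerary_def)

lemma itinerary_stake_in_itineraries:
  "x \<in> infinite_paths E \<Longrightarrow> itinerary E S (stake n x) \<in> itineraries E S n"
  by (simp add: itineraries_def path_words_def)

lemma finite_itineraries:
  assumes "wf_digraph E" "row_finite E" "finite S"
  shows "finite (itineraries E S n)"
proof (rule finite_subset)
  let ?A = "insert None (Some ` (\<Union>v\<in>S. out_arcs E v))"
  show "itineraries E S n \<subseteq> {c. set c \<subseteq> ?A \<and> length c = n}"
    by (auto simp: itineraries_def path_words_def itinerary_def infinite_paths_iff in_set_conv_nth)
  show "finite {c. set c \<subseteq> ?A \<and> length c = n}"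
    by (rule finite_lists_length_eq) (use assms finite_out_arcs[OF assms(1,2)] in blast)
qed

text \<open>Either \<open>v\<close> is not visited before time \<open>n\<close>, or \<open>a\<close>
  is the time of the first visit and \<open>a + k\<close> that of the last. The edge
  \<open>e\<close> taken at the last visit is listed apart: it belongs neither to the closed path
  nor to the pieces avoiding \<open>v\<close>, on which observing \<open>v\<close> changes nothing.
  An inclusion suffices for an upper bound.\<close>

lemma itineraries_insert:
  "itineraries E (insert v S) n \<subseteq> itineraries E S n \<union>
     (\<Union>(a, k)\<in>{(a, k). a + k < n}.
        (\<lambda>(c, b, e, d). c @ itinerary E (insert v S) b @ Some e # d) `
          (itineraries E S a \<times> closed_paths E v k \<times> out_arcs E v \<times> itineraries E S (n - Suc (a + k))))"
    (is "_ \<subseteq> _ \<union> (\<Union>(a, k)\<in>?I. ?f ` ?X a k)")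
proof
  fix w assume "w \<in> itineraries E (insert v S) n"
  then obtain x where x: "x \<in> infinite_paths E" "w = itinerary E (insert v S) (stake n x)"
    by (auto simp: itineraries_def path_words_def)
  define V where "V = {i. i < n \<and> tail E (x !! i) = v}"
  show "w \<in> itineraries E S n \<union> (\<Union>(a, k)\<in>?I. ?f ` ?X a k)"
  proof (cases "V = {}")
    case True
    then have "\<forall>e\<in>set (stake n x). tail E e \<noteq> v"
      by (fastforce simp: V_def in_set_conv_nth)
    then have "w = itinerary E S (stake n x)"
      unfolding x(2) by (rule itinerary_insert)
    then show ?thesis using itinerary_stake_in_itineraries[OF x(1)] by simp
  next
    case False
    have finV: "finite V" by (simp add: V_def)
    define a j where "a = Min V" and "j = Max V"
    have a: "a \<in> V" and j: "j \<in> V" and aj: "a \<le> j"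
      using finV False by (simp_all add: a_def j_def)
    define k where "k = j - a"
    have before: "i \<notin> V" if "i < a" for i
      using Min_le[OF finV, of i] that by (auto simp: a_def)
    have after: "i \<notin> V" if "j < i" for i
      using Max_ge[OF finV, of i] that by (auto simp: j_def)
    have ak: "a + k = j" "j < n" using aj j by (simp_all add: k_def V_def)
    let ?b = "stake k (sdrop a x)" and ?d = "stake (n - Suc j) (sdrop (Suc j) x)"
    \<comment> \<open>The pieces cover the times before \<open>a\<close>, the times from
      \<open>a\<close> up to but excluding \<open>j\<close>, the time \<open>j\<close> itself and
      the times after \<open>j\<close>.\<close>
    have "stake n x = stake (a + k + 1 + (n - Suc j)) x" using ak by simp
    also have "\<dots> = stake a x @ ?b @ [x !! j] @ ?d"
      unfolding stake_add[symmetric] using ak by (simp add: sdrop_snth)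
    finally have "w = itinerary E (insert v S) (stake a x) @ itinerary E (insert v S) ?b @
        itinerary E (insert v S) [x !! j] @ itinerary E (insert v S) ?d"
      by (simp only: x(2) itinerary_append)
    also have "itinerary E (insert v S) (stake a x) = itinerary E S (stake a x)"
      using before ak aj by (intro itinerary_insert) (fastforce simp: V_def in_set_conv_nth)
    also have "itinerary E (insert v S) ?d = itinerary E S ?d"
    proof (intro itinerary_insert ballI)
      fix e assume "e \<in> set ?d"
      then obtain i where "i < n - Suc j" "e = x !! (Suc j + i)"
        by (auto simp: in_set_conv_nth sdrop_snth simp del: sdrop.simps)
      with after[of "Suc j + i"] show "tail E e \<noteq> v" by (auto simp: V_def)
    qed
    also have "itinerary E (insert v S) [x !! j] = [Some (x !! j)]"
      using j by (simp add: itinerary_def V_def)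
    finally have w: "w = ?f (itinerary E S (stake a x), ?b, x !! j, itinerary E S ?d)" by simp
    have b: "?b \<in> closed_paths E v k"
      unfolding closed_paths_def using sdrop_infinite_paths[OF x(1)] a j ak
      by (intro imageI) (auto simp: sdrop_snth V_def)
    moreover have "x !! j \<in> out_arcs E v"
      using x(1) j by (auto simp: infinite_paths_iff V_def)
    moreover have "itinerary E S ?d \<in> itineraries E S (n - Suc (a + k))"
      unfolding ak by (intro itinerary_stake_in_itineraries sdrop_infinite_paths x)
    moreover have "itinerary E S (stake a x) \<in> itineraries E S a"
      by (rule itinerary_stake_in_itineraries[OF x(1)])
    ultimately have "(itinerary E S (stake a x), ?b, x !! j, itinerary E S ?d) \<in> ?X a k"
      using b by (intro SigmaI)
    with w have "w \<in> ?f ` ?X a k" by (rule image_eqI)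
    then show ?thesis using ak by blast
  qed
qed

text \<open>For fixed \<open>(a, k)\<close> the exponential factors multiply to at most
  \<open>exp (h * n)\<close> and the two polynomial factors to degree \<open>2 * K\<close>. The
  number of pairs \<open>(a, k)\<close> is at most quadratic, which adds 2 to the degree.\<close>

lemma card_itineraries_insert_le:
  assumes E: "wf_digraph E" "row_finite E" "finite S"
    and "h \<ge> 0" and closed: "\<And>l. real (card (closed_paths E v l)) \<le> exp (h * real l)"
    and B: "\<And>n. real (card (itineraries E S n)) \<le> B * real (n + 1) ^ K * exp (h * real n)" "B \<ge> 0"
  shows "real (card (itineraries E (insert v S) n))
    \<le> (B + B\<^sup>2 * card (out_arcs E v)) * real (n + 1) ^ (2 * K + 2) * exp (h * real n)"
proof -
  let ?f = "\<lambda>(c, b, e, d). c @ itinerary E (insert v S) b @ Some e # d"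
  let ?X = "\<lambda>a k. itineraries E S a \<times> closed_paths E v k \<times> out_arcs E v \<times> itineraries E S (n - Suc (a + k))"
  let ?I = "{(a, k). a + k < n}"
  let ?D = "real (card (out_arcs E v))" and ?N = "real (n + 1)"
  have sub: "?I \<subseteq> {..<n} \<times> {..<n}" by auto
  then have finI: "finite ?I" by (rule finite_subset) simp
  have "card ?I \<le> n * n" using card_mono[OF _ sub] by simp
  also have "\<dots> \<le> (n + 1)\<^sup>2" by (simp add: power2_eq_square)
  finally have "card ?I \<le> (n + 1)\<^sup>2" .
  then have cardI: "real (card ?I) \<le> ?N\<^sup>2"
    by (metis of_nat_le_iff of_nat_power)
  have finX: "finite (?X a k)" for a k
    using finite_itineraries[OF E] finite_closed_paths[OF E(1,2)] finite_out_arcs[OF E(1,2)]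
    by blast
  have X: "real (card (?f ` ?X a k)) \<le> B\<^sup>2 * ?D * ?N ^ (2 * K) * exp (h * n)" if ak: "a + k < n" for a k
  proof -
    let ?c = "n - Suc (a + k)"
    have N: "real (card (itineraries E S i)) \<le> B * ?N ^ K * exp (h * i)" if "i \<le> n" for i
      by (rule order_trans[OF B(1)]) (use that B(2) in \<open>intro mult_right_mono mult_left_mono power_mono; simp\<close>)
    have "real (card (?f ` ?X a k)) \<le> real (card (?X a k))"
      using card_image_le[OF finX] by simp
    also have "\<dots> = card (itineraries E S a) * (card (closed_paths E v k) * (?D * card (itineraries E S ?c)))"
      by (simp add: card_cartesian_product)
    also have "\<dots> \<le> (B * ?N ^ K * exp (h * a)) * (exp (h * k) * (?D * (B * ?N ^ K * exp (h * ?c))))"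
      using ak by (intro mult_mono N closed) (auto simp: B(2))
    also have "\<dots> = B\<^sup>2 * ?D * ?N ^ (2 * K) * (exp (h * a) * exp (h * k) * exp (h * ?c))"
      by (simp add: power2_eq_square power_add mult_2)
    \<comment> \<open>The lengths add up to \<open>n - 1\<close>; the missing unit is the edge
      \<open>e\<close>.\<close>
    also have "exp (h * a) * exp (h * k) * exp (h * ?c) = exp (h * (a + k + ?c))"
      by (simp add: exp_add[symmetric] algebra_simps)
    also have "\<dots> \<le> exp (h * n)"
      using ak \<open>h \<ge> 0\<close> by (simp add: mult_left_mono)
    finally show ?thesis by (simp add: B(2) mult_left_mono)
  qed
  have "real (card (itineraries E (insert v S) n))
      \<le> real (card (itineraries E S n \<union> (\<Union>(a, k)\<in>?I. ?f ` ?X a k)))"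
    using finI finX finite_itineraries[OF E]
    by (intro of_nat_mono card_mono itineraries_insert) (auto simp del: finite_SigmaI)
  also have "\<dots> \<le> real (card (itineraries E S n)) + real (card (\<Union>(a, k)\<in>?I. ?f ` ?X a k))"
    by (simp only: of_nat_add[symmetric] of_nat_le_iff card_Un_le)
  also have "real (card (\<Union>(a, k)\<in>?I. ?f ` ?X a k)) \<le> (\<Sum>(a, k)\<in>?I. real (card (?f ` ?X a k)))"
    using card_UN_le[OF finI, of "\<lambda>(a, k). ?f ` ?X a k"]
    by (simp add: case_prod_beta' flip: of_nat_sum)
  also have "\<dots> \<le> real (card ?I) * (B\<^sup>2 * ?D * ?N ^ (2 * K) * exp (h * n))"
    by (rule sum_bounded_above) (use X in auto)
  also have "\<dots> \<le> ?N\<^sup>2 * (B\<^sup>2 * ?D * ?N ^ (2 * K) * exp (h * n))"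
    using cardI by (intro mult_right_mono) auto
  also have "\<dots> = B\<^sup>2 * ?D * ?N ^ (2 * K + 2) * exp (h * n)"
    by (simp add: power_add power2_eq_square)
  also have "real (card (itineraries E S n)) \<le> B * ?N ^ (2 * K + 2) * exp (h * n)"
    by (rule order_trans[OF B(1)])
       (use B(2) in \<open>intro mult_right_mono mult_left_mono power_increasing; simp\<close>)
  finally show ?thesis by (simp add: algebra_simps)
qed

text \<open>The degree more than doubles with each vertex, which is harmless because
  \<open>S\<close> stays fixed while \<open>n\<close> grows.\<close>

lemma card_itineraries_le:
  assumes E: "wf_digraph E" "row_finite E" and S: "finite S"
    and "h \<ge> 0" and closed: "\<And>v l. real (card (closed_paths E v l)) \<le> exp (h * real l)"
  shows "\<exists>B\<ge>0. \<exists>K. \<forall>n. real (card (itineraries E S n)) \<le> B * real (n + 1) ^ K * exp (h * real n)"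
  using S
proof induction
  case empty
  \<comment> \<open>When no vertex is observed, every path has the all-blank itinerary.\<close>
  have "card (itineraries E {} n) \<le> card {replicate n (None :: 'b option)}" for n
    by (rule card_mono)
       (auto simp: itineraries_def path_words_def itinerary_def map_replicate_const)
  then have "real (card (itineraries E {} n)) \<le> 1" for n by simp
  also have "1 \<le> exp (h * real n)" for n using \<open>h \<ge> 0\<close> by simp
  finally show ?case by (intro exI[of _ 1] conjI exI[of _ 0]) simp_all
next
  case (insert v S)
  then obtain B K where B: "B \<ge> 0"
    "\<And>n. real (card (itineraries E S n)) \<le> B * real (n + 1) ^ K * exp (h * real n)" by blast
  from card_itineraries_insert_le[OF E insert.hyps(1) \<open>h \<ge> 0\<close> closed B(2,1)] B(1)
  show ?case
    by (intro exI[of _ "B + B\<^sup>2 * card (out_arcs E v)"] conjI exI[of _ "2 * K + 2"] allI) auto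
qed

section \<open>Separated sets of paths\<close>

lemma itinerary_stake_eqD:
  assumes "itinerary E S (stake n x) = itinerary E S (stake n y)" "i < n" "tail E (x !! i) \<in> S"
  shows "y !! i = x !! i"
proof -
  have "itinerary E S (stake n x) ! i = itinerary E S (stake n y) ! i"
    using assms(1) by simp
  then show ?thesis using assms(2,3) by (simp add: itinerary_def split: if_splits)
qed

text \<open>The edges witnessing that \<open>x\<close> starts with \<open>q\<close> have their
  sources in \<open>S\<close>, so the itinerary of \<open>x\<close> shows them and \<open>y\<close>
  has the same ones. For a vertex set the witness is the first edge, hence
  \<open>0 < n\<close>.\<close>

lemma initial_segment_cong:
  assumes x: "x \<in> infinite_paths E" and y: "y \<in> infinite_paths E"
    and eq: "itinerary E S (stake n x) = itinerary E S (stake n y)"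
    and q: "case q of Inl b \<Rightarrow> tail E ` set b \<subseteq> S \<and> length b \<le> n | Inr A \<Rightarrow> A \<subseteq> S \<and> 0 < n"
    and "initial_segment E q x"
  shows "initial_segment E q y"
proof (cases q)
  case (Inl b)
  then have b: "stake (length b) x = b"
    using assms(5) initial_segment_Inl_iff[OF x] by simp
  have "y !! i = x !! i" if "i < length b" for i
  proof (rule itinerary_stake_eqD[OF eq])
    show "i < n" using q that Inl by simp
    have "b ! i \<in> set b" using that by simp
    moreover have "b ! i = x !! i" using b that by (metis stake_nth)
    ultimately show "tail E (x !! i) \<in> S" using q Inl by auto
  qed
  then have "stake (length b) y = stake (length b) x" by (simp add: stake_eq_iff)
  then show ?thesis using b Inl initial_segment_Inl_iff[OF y] by simp
next
  case (Inr A)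
  then show ?thesis
    using assms(5) q itinerary_stake_eqD[OF eq, of 0] by (auto simp: subset_iff)
qed

section \<open>Distances and separating segments\<close>

lemma enumerates_Inl_stake:
  assumes "enumerates p (segments E)" "x \<in> infinite_paths E" "n > 0"
  shows "\<exists>j\<in>index_set (segments E). p j = Inl (stake n x)"
proof -
  have "Inl (stake n x) \<in> segments E"
    using stake_finite_paths[OF assms(2,3)] by (auto simp: segments_def)
  then show ?thesis
    using assms(1) unfolding enumerates_def bij_betw_def by (metis imageE)
qed

lemma path_dist_ge:
  assumes x: "x \<in> infinite_paths E" and y: "y \<in> infinite_paths E"
    and "stake n x \<noteq> stake n y" "j \<in> index_set (segments E)" "p j = Inl (stake n x)"
  shows "(1/2) ^ j \<le> path_dist E p x y"
proof -
  have "initial_segment E (p j) x \<noteq> initial_segment E (p j) y"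
    using assms(3) initial_segment_Inl_iff[OF x] initial_segment_Inl_iff[OF y]
    by (auto simp: assms(5))
  then have "(LEAST i. i \<in> index_set (segments E) \<and>
      initial_segment E (p i) x \<noteq> initial_segment E (p i) y) \<le> j"
    using assms(4) by (intro Least_le) auto
  then show ?thesis
    using assms(3) unfolding path_dist_def by (auto intro: power_decreasing)
qed

lemma path_dist_gt_imp:
  assumes p: "enumerates p (segments E)"
    and x: "x \<in> infinite_paths E" and y: "y \<in> infinite_paths E"
    and "path_dist E p x y > (1/2) ^ N"
  shows "\<exists>j\<in>index_set (segments E). j < N \<and>
    initial_segment E (p j) x \<noteq> initial_segment E (p j) y"
proof -
  let ?P = "\<lambda>i. i \<in> index_set (segments E) \<and> initial_segment E (p i) x \<noteq> initial_segment E (p i) y"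
  have ne: "x \<noteq> y" using assms(4) by (auto simp: path_dist_def not_less)
  \<comment> \<open>The index under \<open>LEAST\<close> exists because distinct paths differ in
    some prefix and every nonempty prefix is enumerated.\<close>
  then obtain i where "x !! i \<noteq> y !! i" by (metis stream_smap_nats ext)
  then have i: "stake (Suc i) x \<noteq> stake (Suc i) y" by (auto simp: stake_eq_iff simp del: stake.simps)
  obtain j where "j \<in> index_set (segments E)" "p j = Inl (stake (Suc i) x)"
    using enumerates_Inl_stake[OF p x, of "Suc i"] by auto
  moreover from this(2) have "initial_segment E (p j) x \<noteq> initial_segment E (p j) y"
    using i initial_segment_Inl_iff[OF x] initial_segment_Inl_iff[OF y]
    by (auto simp del: stake.simps)
  ultimately have "?P (LEAST i. ?P i)" by (intro LeastI[of ?P j]) auto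
  moreover have "(1/2) ^ N < (1/2 :: real) ^ (LEAST i. ?P i)"
    using assms(4) ne by (simp add: path_dist_def)
  then have "(LEAST i. ?P i) < N"
    by (subst (asm) power_strict_decreasing_iff) simp_all
  ultimately show ?thesis by blast
qed

text \<open>A distance above \<epsilon> is due to one of the finitely many segments of index below
  \<open>N\<close>. \<open>S\<close> collects the vertices these involve, and \<open>L\<close>
  exceeds their lengths, so equal itineraries would give both paths the same segments among
  them.\<close>

lemma path_dist_gt_imp_itinerary:
  assumes E: "wf_digraph E" and p: "enumerates p (segments E)" and "\<epsilon> > 0"
  shows "\<exists>S L. finite S \<and> (\<forall>x\<in>infinite_paths E. \<forall>y\<in>infinite_paths E.
    path_dist E p x y > \<epsilon> \<longrightarrow> itinerary E S (stake L x) \<noteq> itinerary E S (stake L y))"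
proof -
  obtain N where N: "(1/2) ^ N < \<epsilon>"
    using real_arch_pow_inv[OF \<open>\<epsilon> > 0\<close>, of "1/2"] by auto
  define J where "J = {j \<in> index_set (segments E). j < N}"
  define V where "V q = (case q of Inl b \<Rightarrow> tail E ` set b | Inr A \<Rightarrow> A)" for q
  define l where "l q = (case q of Inl b \<Rightarrow> length b | Inr A \<Rightarrow> 0)" for q :: "'b list + 'a set"
  define S where "S = (\<Union>j\<in>J. V (p j))"
  \<comment> \<open>The sum bounds every length; the successor keeps the first edge inside the
    window even if only vertex sets occur.\<close>
  define L where "L = Suc (\<Sum>j\<in>J. l (p j))"
  have finJ: "finite J" by (simp add: J_def)
  have "finite (V (p j))" if "j \<in> J" for j
  proof -
    have "p j \<in> segments E"
      using p that by (auto simp: enumerates_def bij_betw_def J_def)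
    then show ?thesis by (auto simp: segments_def V_def)
  qed
  then have "finite S" using finJ by (simp add: S_def)
  moreover have "itinerary E S (stake L x) \<noteq> itinerary E S (stake L y)"
    if x: "x \<in> infinite_paths E" and y: "y \<in> infinite_paths E" and d: "path_dist E p x y > \<epsilon>" for x y
  proof
    assume eq: "itinerary E S (stake L x) = itinerary E S (stake L y)"
    have "path_dist E p x y > (1/2) ^ N" using N d by simp
    from path_dist_gt_imp[OF p x y this] obtain j where j: "j \<in> J"
      "initial_segment E (p j) x \<noteq> initial_segment E (p j) y" by (auto simp: J_def)
    have "V (p j) \<subseteq> S" using j(1) by (auto simp: S_def)
    moreover have "l (p j) \<le> L" using j(1) finJ by (auto simp: L_def intro!: le_SucI member_le_sum)
    ultimately have "case p j of Inl b \<Rightarrow> tail E ` set b \<subseteq> S \<and> length b \<le> L | Inr A \<Rightarrow> A \<subseteq> S \<and> 0 < L"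
      by (auto simp: V_def l_def L_def split: sum.splits)
    from initial_segment_cong[OF x y eq this] initial_segment_cong[OF y x eq[symmetric] this] j(2)
    show False by blast
  qed
  ultimately show ?thesis by blast
qed

section \<open>Separated sets and itineraries\<close>

definition separated :: "('a \<Rightarrow> 'a \<Rightarrow> real) \<Rightarrow> nat \<Rightarrow> real \<Rightarrow> ('a \<Rightarrow> 'a) \<Rightarrow> 'a set \<Rightarrow> bool" where
  "separated d n \<epsilon> f A \<longleftrightarrow> finite A \<and> (\<forall>x\<in>A. \<forall>y\<in>A. x \<noteq> y \<longrightarrow> bowen_dist d f n x y > \<epsilon>)"

lemma sep_eq: "sep d n \<epsilon> f K = Max (card ` {A. A \<subseteq> K \<and> separated d n \<epsilon> f A})"
  unfolding sep_def separated_def by (rule arg_cong[of _ _ Max]) auto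

text \<open>Some shift by \<open>i < n\<close> carries two separated points to distance above
  \<epsilon>, so their windows of length \<open>L\<close> at \<open>i\<close> have different
  itineraries. These windows lie within the first \<open>n + L\<close> edges, hence the itinerary is
  injective on a separated set.\<close>

lemma card_separated_le:
  assumes E: "wf_digraph E" "row_finite E" and p: "enumerates p (segments E)" and "\<epsilon> > 0"
  shows "\<exists>S L. finite S \<and> (\<forall>n>0. \<forall>A\<subseteq>infinite_paths E.
    separated (path_dist E p) n \<epsilon> stl A \<longrightarrow> card A \<le> card (itineraries E S (n + L)))"
proof -
  obtain S L where S: "finite S" and L: "\<And>x y. x \<in> infinite_paths E \<Longrightarrow> y \<in> infinite_paths E \<Longrightarrow>
      path_dist E p x y > \<epsilon> \<Longrightarrow> itinerary E S (stake L x) \<noteq> itinerary E S (stake L y)"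
    using path_dist_gt_imp_itinerary[OF E(1) p \<open>\<epsilon> > 0\<close>] by blast
  have "card A \<le> card (itineraries E S (n + L))"
    if "n > 0" "A \<subseteq> infinite_paths E" "separated (path_dist E p) n \<epsilon> stl A" for n A
  proof (rule card_inj_on_le)
    show "(\<lambda>x. itinerary E S (stake (n + L) x)) ` A \<subseteq> itineraries E S (n + L)"
      using that(2) itinerary_stake_in_itineraries by blast
    show "finite (itineraries E S (n + L))" by (rule finite_itineraries[OF E S])
    show "inj_on (\<lambda>x. itinerary E S (stake (n + L) x)) A"
    proof (rule inj_onI, rule ccontr)
      fix x y assume xy: "x \<in> A" "y \<in> A" "x \<noteq> y"
        and eq: "itinerary E S (stake (n + L) x) = itinerary E S (stake (n + L) y)"
      \<comment> \<open>As \<open>n > 0\<close>, the maximum is over a nonempty finite set and is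
        attained at some shift.\<close>
      have "bowen_dist (path_dist E p) stl n x y \<in> (\<lambda>i. path_dist E p (sdrop i x) (sdrop i y)) ` {..<n}"
        unfolding bowen_dist_def funpow_stl using \<open>n > 0\<close> by (intro Max_in) auto
      moreover have "bowen_dist (path_dist E p) stl n x y > \<epsilon>"
        using that(3) xy by (simp add: separated_def)
      ultimately obtain i where i: "i < n" "path_dist E p (sdrop i x) (sdrop i y) > \<epsilon>" by auto
      have split: "itinerary E S (stake (n + L) z) = itinerary E S (stake i z) @
          itinerary E S (stake L (sdrop i z)) @ itinerary E S (stake (n - i) (sdrop (i + L) z))" for z
      proof -
        have "stake (n + L) z = stake (i + (L + (n - i))) z" using i(1) by (intro arg_cong2[of _ _ _ _ stake]) auto
        also have "\<dots> = stake i z @ stake L (sdrop i z) @ stake (n - i) (sdrop (i + L) z)"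
          by (simp only: stake_add[symmetric] sdrop_add)
        finally show ?thesis by simp
      qed
      have "itinerary E S (stake L (sdrop i x)) = itinerary E S (stake L (sdrop i y))"
        using eq unfolding split by (simp add: itinerary_def)
      moreover have "x \<in> infinite_paths E" "y \<in> infinite_paths E" using xy that(2) by auto
      ultimately show False
        using L[OF _ _ i(2)] sdrop_infinite_paths by blast
    qed
  qed
  with S show ?thesis by blast
qed

text \<open>The \<open>Max\<close> in \<open>sep\<close> behaves as a maximum only for a nonempty
  finite set: the empty set is separated, and \<open>card_separated_le\<close> bounds all
  cardinalities.\<close>

lemma
  assumes E: "wf_digraph E" "row_finite E" and p: "enumerates p (segments E)"
    and "\<epsilon> > 0" "n > 0" "K \<subseteq> infinite_paths E"
  shows sep_attained: "\<exists>A\<subseteq>K. separated (path_dist E p) n \<epsilon> stl A \<and> card A = sep (path_dist E p) n \<epsilon> stl K"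
    and card_separated_le_sep: "\<And>A. A \<subseteq> K \<Longrightarrow> separated (path_dist E p) n \<epsilon> stl A \<Longrightarrow>
      card A \<le> sep (path_dist E p) n \<epsilon> stl K"
proof -
  let ?X = "card ` {A. A \<subseteq> K \<and> separated (path_dist E p) n \<epsilon> stl A}"
  obtain S L where "\<forall>n>0. \<forall>A\<subseteq>infinite_paths E.
    separated (path_dist E p) n \<epsilon> stl A \<longrightarrow> card A \<le> card (itineraries E S (n + L))"
    using card_separated_le[OF E p \<open>\<epsilon> > 0\<close>] by blast
  then have "?X \<subseteq> {..card (itineraries E S (n + L))}"
    using assms(5,6) by auto
  then have fin: "finite ?X" by (rule finite_subset) simp
  have "{} \<in> {A. A \<subseteq> K \<and> separated (path_dist E p) n \<epsilon> stl A}" by (simp add: separated_def)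
  then have "Max ?X \<in> ?X" using fin by (intro Max_in) blast+
  then show "\<exists>A\<subseteq>K. separated (path_dist E p) n \<epsilon> stl A \<and> card A = sep (path_dist E p) n \<epsilon> stl K"
    unfolding sep_eq image_iff by (auto simp: eq_commute)
  show "card A \<le> sep (path_dist E p) n \<epsilon> stl K"
    if "A \<subseteq> K" "separated (path_dist E p) n \<epsilon> stl A" for A
    unfolding sep_eq using fin that by (intro Max_ge) auto
qed

section \<open>Metric entropy of the shift\<close>

text \<open>Replaces the limit for \<epsilon> tending to 0 by a supremum, where an upper bound is
  checked scale by scale and a lower bound at a single scale.\<close>

lemma tendsto_at_right_SUP:
  fixes g :: "real \<Rightarrow> 'a :: {complete_linorder, linorder_topology}"
  assumes "\<And>x y. a < x \<Longrightarrow> x \<le> y \<Longrightarrow> g y \<le> g x"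
  shows "(g \<longlongrightarrow> (SUP x\<in>{a<..}. g x)) (at_right a)"
proof (rule order_tendstoI)
  fix c assume "c < (SUP x\<in>{a<..}. g x)"
  then obtain b where b: "a < b" "c < g b" by (auto simp: less_SUP_iff)
  then have "c < g x" if "a < x" "x < b" for x
    using assms[of x b] that by (auto intro: less_le_trans)
  then show "\<forall>\<^sub>F x in at_right a. c < g x"
    using b(1) unfolding eventually_at_right_field by blast
next
  fix c assume c: "(SUP x\<in>{a<..}. g x) < c"
  have "g x < c" if "a < x" for x
    using that by (intro le_less_trans[OF SUP_upper c]) simp
  then show "\<forall>\<^sub>F x in at_right a. g x < c"
    unfolding eventually_at_right_field by (intro exI[of _ "a + 1"]) auto
qed

text \<open>A set separated at one scale is separated at every smaller one, so the upper limit grows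
  as \<epsilon> decreases. Only \<open>n > 0\<close> is compared, since \<open>bowen_dist\<close> at
  \<open>n = 0\<close> is a maximum of the empty set.\<close>

lemma metric_entropy_on_eq_SUP:
  assumes E: "wf_digraph E" "row_finite E" and p: "enumerates p (segments E)"
    and K: "K \<subseteq> infinite_paths E"
  shows "metric_entropy_on (path_dist E p) stl K =
    (SUP \<epsilon>\<in>{0<..}. limsup (\<lambda>n. ennreal (ln (real (sep (path_dist E p) n \<epsilon> stl K)) / real n)))"
  unfolding metric_entropy_on_def
proof (intro tendsto_Lim tendsto_at_right_SUP)
  fix \<epsilon> \<delta> :: real assume \<epsilon>: "0 < \<epsilon>" "\<epsilon> \<le> \<delta>"
  have "ennreal (ln (real (sep (path_dist E p) n \<delta> stl K)) / real n)
      \<le> ennreal (ln (real (sep (path_dist E p) n \<epsilon> stl K)) / real n)" if "n > 0" for n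
  proof -
    obtain A where A: "A \<subseteq> K" "separated (path_dist E p) n \<delta> stl A"
      "card A = sep (path_dist E p) n \<delta> stl K"
      using sep_attained[OF E p _ \<open>n > 0\<close> K, of \<delta>] \<epsilon> by auto
    have "separated (path_dist E p) n \<epsilon> stl A"
      using A(2) \<epsilon>(2) unfolding separated_def by fastforce
    from card_separated_le_sep[OF E p \<epsilon>(1) \<open>n > 0\<close> K A(1) this] A(3)
    show ?thesis
      by (intro ennreal_leI divide_right_mono ln_of_nat_mono) simp_all
  qed
  then show "limsup (\<lambda>n. ennreal (ln (real (sep (path_dist E p) n \<delta> stl K)) / real n))
      \<le> limsup (\<lambda>n. ennreal (ln (real (sep (path_dist E p) n \<epsilon> stl K)) / real n))"
    by (intro Limsup_mono) (auto intro: eventually_mono[OF eventually_gt_at_top[of 0]])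
qed simp

text \<open>At a fixed scale \<open>sep\<close> is at most the number of itineraries of length
  \<open>n + L\<close>. The constants \<open>S\<close>, \<open>L\<close>, \<open>B\<close> and
  \<open>k\<close> depend on the scale, but the growth rate \<open>h\<close> does not.\<close>

lemma metric_entropy_on_le:
  assumes E: "wf_digraph E" "row_finite E" and p: "enumerates p (segments E)"
    and K: "K \<subseteq> infinite_paths E"
    and h: "gurevich_entropy E = ennreal h" "h \<ge> 0"
  shows "metric_entropy_on (path_dist E p) stl K \<le> ennreal h"
  unfolding metric_entropy_on_eq_SUP[OF E p K]
proof (rule SUP_least)
  fix \<epsilon> :: real assume "\<epsilon> \<in> {0<..}"
  then have \<epsilon>: "\<epsilon> > 0" by simp
  obtain S L where S: "finite S" and SL: "\<forall>n>0. \<forall>A\<subseteq>infinite_paths E.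
    separated (path_dist E p) n \<epsilon> stl A \<longrightarrow> card A \<le> card (itineraries E S (n + L))"
    using card_separated_le[OF E p \<epsilon>] by blast
  obtain B k where B: "B \<ge> 0"
    "\<And>n. real (card (itineraries E S n)) \<le> B * real (n + 1) ^ k * exp (h * real n)"
    using card_itineraries_le[OF E S h(2) card_closed_paths_le[OF E h]] by blast
  \<comment> \<open>The logarithm of the bound, over \<open>n\<close>. Passing from \<open>B\<close>
    to \<open>B + 1\<close> makes its logarithm nonnegative, which also covers
    \<open>card A = 0\<close>, where \<open>ln 0 = 0\<close>.\<close>
  define u where "u n = (ln (B + 1) + k * ln (real n + L + 1) + h * (real n + L)) / n" for n :: nat
  have "ln (real (sep (path_dist E p) n \<epsilon> stl K)) / n \<le> u n" if "n > 0" for n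
  proof -
    let ?N = "real n + L + 1"
    obtain A where A: "A \<subseteq> K" "separated (path_dist E p) n \<epsilon> stl A"
      "card A = sep (path_dist E p) n \<epsilon> stl K"
      using sep_attained[OF E p \<epsilon> \<open>n > 0\<close> K] by auto
    have "card A \<le> card (itineraries E S (n + L))" using SL A K \<open>n > 0\<close> by blast
    then have "real (card A) \<le> B * ?N ^ k * exp (h * (real n + L))"
      using B(2)[of "n + L"] by (simp add: algebra_simps)
    also have "\<dots> \<le> (B + 1) * ?N ^ k * exp (h * (real n + L))"
      by (intro mult_right_mono) auto
    finally have le: "real (card A) \<le> (B + 1) * ?N ^ k * exp (h * (real n + L))" .
    have "ln (real (card A)) \<le> ln (B + 1) + k * ln ?N + h * (real n + L)"
    proof (cases "card A = 0")
      case True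
      then show ?thesis using B(1) h(2) by simp
    next
      case False
      then have "ln (real (card A)) \<le> ln ((B + 1) * ?N ^ k * exp (h * (real n + L)))"
        using le by (intro ln_mono) auto
      also have "\<dots> = ln (B + 1) + k * ln ?N + h * (real n + L)"
        using B(1) by (simp add: ln_mult ln_realpow)
      finally show ?thesis .
    qed
    then show ?thesis unfolding u_def A(3) by (intro divide_right_mono) auto
  qed
  then have "limsup (\<lambda>n. ennreal (ln (real (sep (path_dist E p) n \<epsilon> stl K)) / real n))
      \<le> limsup (\<lambda>n. ennreal (u n))"
    by (intro Limsup_mono)
       (auto intro!: eventually_mono[OF eventually_gt_at_top[of 0]] ennreal_leI)
  also have "u \<longlonglongrightarrow> h" unfolding u_def by real_asymp
  then have "limsup (\<lambda>n. ennreal (u n)) = ennreal h"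
    by (intro lim_imp_Limsup tendsto_ennrealI) simp_all
  finally show "limsup (\<lambda>n. ennreal (ln (real (sep (path_dist E p) n \<epsilon> stl K)) / real n)) \<le> ennreal h" .
qed

text \<open>Only finitely many words of length \<open>Suc L\<close> occur in \<open>H\<close>, so
  their indices are bounded and paths of \<open>H\<close> that differ within \<open>Suc L\<close>
  edges are uniformly apart. One path is taken for each word of length \<open>n + L\<close>, to
  match the count coming from open covers.\<close>

lemma ex_separated_path_words:
  assumes H: "subgraph H E" "finite (arcs H)" and p: "enumerates p (segments E)"
  shows "\<exists>\<epsilon>>0. \<forall>n>0. \<exists>A\<subseteq>infinite_paths H.
    separated (path_dist E p) n \<epsilon> stl A \<and> card A = card (path_words H (n + L))"
proof -
  have HE: "infinite_paths H \<subseteq> infinite_paths E" by (rule infinite_paths_subgraph[OF H(1)])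
  have "\<forall>b\<in>path_words H (Suc L). \<exists>j. j \<in> index_set (segments E) \<and> p j = Inl b"
  proof
    fix b assume "b \<in> path_words H (Suc L)"
    then obtain x where x: "x \<in> infinite_paths E" and b: "b = stake (Suc L) x"
      using HE unfolding path_words_def by (auto simp del: stake.simps)
    from enumerates_Inl_stake[OF p x, of "Suc L"]
    show "\<exists>j. j \<in> index_set (segments E) \<and> p j = Inl b" unfolding b by auto
  qed
  from bchoice[OF this] obtain j where
    j: "\<forall>b\<in>path_words H (Suc L). j b \<in> index_set (segments E) \<and> p (j b) = Inl b" ..
  \<comment> \<open>An upper bound for all the indices; the scale \<open>(1/2) ^ Suc m\<close> is
    then strictly below every such distance.\<close>
  define m where "m = (\<Sum>b\<in>path_words H (Suc L). j b)"
  have dist: "(1/2) ^ Suc m < path_dist E p x y"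
    if "x \<in> infinite_paths H" "y \<in> infinite_paths H" "stake (Suc L) x \<noteq> stake (Suc L) y" for x y
  proof -
    have b: "stake (Suc L) x \<in> path_words H (Suc L)" using that(1) unfolding path_words_def by blast
    then have "j (stake (Suc L) x) \<le> m"
      unfolding m_def using finite_path_words[OF H(2)] by (intro member_le_sum) auto
    then have "(1/2 :: real) ^ Suc m < (1/2) ^ j (stake (Suc L) x)"
      by (intro power_strict_decreasing) auto
    also have "\<dots> \<le> path_dist E p x y"
      using j b that HE by (intro path_dist_ge[of _ _ _ "Suc L"]) auto
    finally show ?thesis .
  qed
  have "\<exists>A\<subseteq>infinite_paths H. separated (path_dist E p) n ((1/2) ^ Suc m) stl A \<and>
      card A = card (path_words H (n + L))" if "n > 0" for n
  proof -
    define r where "r = inv_into (infinite_paths H) (stake (n + L))"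
    have r: "r w \<in> infinite_paths H" "stake (n + L) (r w) = w" if "w \<in> path_words H (n + L)" for w
      using that unfolding r_def path_words_def by (auto intro: inv_into_into f_inv_into_f)
    let ?A = "r ` path_words H (n + L)"
    have "inj_on r (path_words H (n + L))" by (rule inj_on_inverseI[of _ "stake (n + L)"]) (rule r(2))
    then have "card ?A = card (path_words H (n + L))" by (rule card_image)
    moreover have "bowen_dist (path_dist E p) stl n x y > (1/2) ^ Suc m"
      if xy: "x \<in> ?A" "y \<in> ?A" "x \<noteq> y" for x y
    proof -
      have X: "x \<in> infinite_paths H" "y \<in> infinite_paths H" using r(1) xy by auto
      have "stake (n + L) x \<noteq> stake (n + L) y" using xy r(2) by auto
      then obtain k where k: "k < n + L" "x !! k \<noteq> y !! k" by (auto simp: stake_eq_iff)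
      \<comment> \<open>The last admissible shift not beyond the difference at \<open>k\<close>. If
        \<open>k \<ge> n\<close>, then \<open>i = n - 1\<close> and \<open>k - i \<le> L\<close>, so
        the difference is still inside a window of length \<open>Suc L\<close>.\<close>
      define i where "i = min k (n - 1)"
      have i: "i < n" "i \<le> k" "k - i < Suc L" using \<open>n > 0\<close> k(1) by (auto simp: i_def)
      have "stake (Suc L) (sdrop i x) \<noteq> stake (Suc L) (sdrop i y)"
        using i k(2) unfolding stake_eq_iff sdrop_snth by (metis le_add_diff_inverse)
      then have "(1/2) ^ Suc m < path_dist E p (sdrop i x) (sdrop i y)"
        by (intro dist sdrop_infinite_paths X)
      also have "\<dots> \<le> bowen_dist (path_dist E p) stl n x y"
        unfolding bowen_dist_def funpow_stl using i(1) by (intro Max_ge) auto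
      finally show ?thesis .
    qed
    ultimately show ?thesis
      using r(1) finite_path_words[OF H(2), of "n + L"]
      by (intro exI[of _ ?A]) (auto simp: separated_def)
  qed
  then show ?thesis by (intro exI[of _ "(1/2) ^ Suc m"]) simp
qed

text \<open>The length \<open>L\<close> obtained from the cover is also the one for which the
  separated sets are built, so \<open>?M n\<close> is at most \<open>sep\<close> for every
  \<open>n > 0\<close>, without any correction in \<open>n\<close>.\<close>

lemma topological_entropy_le_metric_entropy_on:
  assumes E: "row_finite E" and p: "enumerates p (segments E)"
    and H: "subgraph H E" "finite (arcs H)"
  shows "topological_entropy (path_topology H) stl
    \<le> metric_entropy_on (path_dist E p) stl (infinite_paths H)"
  unfolding topological_entropy_def
proof (rule SUP_least)
  fix \<U> assume "\<U> \<in> {\<U>. open_cover (path_topology H) \<U>}"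
  then have U: "open_cover (path_topology H) \<U>" by simp
  have wf: "wf_digraph E" "wf_digraph H" using H(1) by (auto simp: subgraph_def)
  let ?M = "\<lambda>n. min_subcover_card (path_topology H) (iterated_join (path_topology H) stl n \<U>)"
  obtain L where L: "\<And>n. ?M n \<le> card (path_words H (n + L))"
    using min_subcover_card_le_card_path_words[OF H(2) wf(2) U] by blast
  obtain \<epsilon> where \<epsilon>: "\<epsilon> > 0" "\<forall>n>0. \<exists>A\<subseteq>infinite_paths H.
    separated (path_dist E p) n \<epsilon> stl A \<and> card A = card (path_words H (n + L))"
    using ex_separated_path_words[OF H p] by blast
  have HE: "infinite_paths H \<subseteq> infinite_paths E" by (rule infinite_paths_subgraph[OF H(1)])
  have "ennreal (ln (real (?M n)) / real n)
      \<le> ennreal (ln (real (sep (path_dist E p) n \<epsilon> stl (infinite_paths H))) / real n)" if n: "n > 0" for n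
  proof -
    obtain A where A: "A \<subseteq> infinite_paths H" "separated (path_dist E p) n \<epsilon> stl A"
      "card A = card (path_words H (n + L))" using \<epsilon>(2)[THEN spec, THEN mp, OF n] by auto
    from card_separated_le_sep[OF wf(1) E p \<epsilon>(1) n HE A(1,2)] L[of n] A(3)
    show ?thesis by (intro ennreal_leI divide_right_mono ln_of_nat_mono) simp_all
  qed
  then have "limsup (\<lambda>n. ennreal (ln (real (?M n)) / real n))
      \<le> limsup (\<lambda>n. ennreal (ln (real (sep (path_dist E p) n \<epsilon> stl (infinite_paths H))) / real n))"
    by (intro Limsup_mono) (auto intro: eventually_mono[OF eventually_gt_at_top[of 0]])
  also have "\<dots> \<le> metric_entropy_on (path_dist E p) stl (infinite_paths H)"
    unfolding metric_entropy_on_eq_SUP[OF wf(1) E p HE] using \<epsilon>(1) by (intro SUP_upper) simp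
  finally show "limsup (\<lambda>n. ennreal (ln (real (?M n)) / real n))
      \<le> metric_entropy_on (path_dist E p) stl (infinite_paths H)" .
qed

theorem corollary7p20:
  fixes E :: "('v, 'e) pre_digraph"
    and p :: "nat \<Rightarrow> 'e list + 'v set"
  assumes "countable_graph E"
    and "locally_finite E"
    and "no_sinks E"
    and "enumerates p (segments E)"
  shows "metric_entropy (path_topology E) (path_dist E p) stl = gurevich_entropy E"
proof (rule antisym)
  have E: "wf_digraph E" "row_finite E"
    using assms by (auto simp: countable_graph_def locally_finite_def)
  show "metric_entropy (path_topology E) (path_dist E p) stl \<le> gurevich_entropy E"
  proof (cases "gurevich_entropy E")
    \<comment> \<open>For infinite \<open>gurevich_entropy E\<close> there is nothing to show;
      otherwise the bound \<open>h\<close> is uniform in \<open>K\<close>.\<close>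
    case (real h)
    have "metric_entropy_on (path_dist E p) stl K \<le> ennreal h"
      if "compactin (path_topology E) K" for K
      using compactin_subset_topspace[OF that] metric_entropy_on_le[OF E assms(4) _ real(2,1)]
      by simp
    then show ?thesis unfolding real(2) metric_entropy_def by (intro SUP_least) simp
  qed simp
  show "gurevich_entropy E \<le> metric_entropy (path_topology E) (path_dist E p) stl"
    unfolding gurevich_entropy_def
  proof (rule SUP_least)
    fix H assume "H \<in> {H. subgraph H E \<and> fin_digraph H \<and> Digraph_Component.connected H}"
    then have H: "subgraph H E" "finite (arcs H)"
      by (auto simp: fin_digraph_def fin_digraph_axioms_def)
    have "topological_entropy (path_topology H) stl
        \<le> metric_entropy_on (path_dist E p) stl (infinite_paths H)"
      by (rule topological_entropy_le_metric_entropy_on[OF E(2) assms(4) H])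
    \<comment> \<open>The path space of \<open>H\<close> is one of the compact sets in the
      supremum.\<close>
    also have "\<dots> \<le> metric_entropy (path_topology E) (path_dist E p) stl"
      unfolding metric_entropy_def using compactin_infinite_paths[OF H] by (intro SUP_upper) simp
    finally show "topological_entropy (path_topology H) stl
        \<le> metric_entropy (path_topology E) (path_dist E p) stl" .
  qed
qed

end
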